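(* Given an integer $m\geq 1$ and initial conditions $(\eta_0,u_0)\in \widetilde{C}^m_0\times C^{m+1}_0$, there exists a time $T_m>0$ such that the system of integral equations $$\eta(x,t)=\eta_0(x)+\int_0^t \left[ L_N\!\left(\tfrac{a+b}{b}u+\eta u\right)+\tfrac{a}{b}u_x \right] d\tau,\qquad u(x,t)=u_0(x)+\int_0^t L_D\!\left(\eta+\tfrac{1}{2}u^2\right)d\tau$$ has a unique solution $(\eta,u)\in C(0,T_m;\widetilde{C}^m_0)\times C(0,T_m;C^{m+1}_0)$.
   Context: Fix $L>0$ and real parameters $a<0$, $b>0$, $d>0$ with $a+b+d=\tfrac13$. $C^s=C^s(-L,L)$ is the Banach space of real-valued $s$-times continuously differentiable functions on $[-L,L]$ with norm $\|v\|_{C^s}=\sup_{0\le j\le s}\sup_{x\in[-L,L]}|\partial_x^jv(x)|$. For $m\ge1$, $$C_0^{m+1}:=\{w\in C^{m+1}: w(\pm L)=0,\ w_{xx}(\pm L)=0\},\qquad \widetilde C_0^m:=\{v\in C^m: v_x(\pm L)=0\}.$$ $C(0,T;X)$ denotes continuous functions of $t\in[0,T]$ with values in $X$. The operator $L_N$ is defined by $(L_Nf)(x)=\int_{-L}^{L}F_\xi(x,\xi)f(\xi)\,d\xi$, where $F_\xi=\partial F/\partial\xi$, $$F(x,\xi)=-\frac{1}{bW}\begin{cases}\omega_1(\xi)\omega_2(x), & -L\le\xi\le x,\\ \omega_1(x)\omega_2(\xi), & x<\xi\le L,\end{cases}$$ $\omega_1(x)=\cosh\left(\frac{L+x}{\sqrt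 b}\right)$, $\omega_2(x)=\cosh\left(\frac{L-x}{\sqrt b}\right)$, $W=-\frac{1}{\sqrt b}\sinh\left(\frac{2L}{\sqrt b}\right)$ ($F$ is the Green's function of $w-bw_{xx}=-f_x$, $w_x(\pm L)=0$). The operator $L_D$ is defined by $(L_Df)(x)=\int_{-L}^{L}G_\xi(x,\xi)f(\xi)\,d\xi$, where $G$ is given by the same formula with $b$ replaced by $d$, $\omega_1(x)=\sinh\left(\frac{L+x}{\sqrt d}\right)$, $\omega_2(x)=\sinh\left(\frac{L-x}{\sqrt d}\right)$, $W=-\frac{1}{\sqrt d}\sinh\left(\frac{2L}{\sqrt d}\right)$ ($G$ is the Green's function of $w-dw_{xx}=-f_x$, $w(\pm L)=0$). Both operators act in the variable $x$ at each fixed time. *)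

theory Defs
  imports "HOL-Analysis.Analysis"
begin

text \<open>Functions on \<open>[-L, L]\<close> are represented by total functions \<open>real \<Rightarrow> real\<close> of which only the
  values on \<open>[-L, L]\<close> matter. Derivatives are taken within the interval, hence are one-sided at
  the end points.\<close>

definition Dx :: "real \<Rightarrow> (real \<Rightarrow> real) \<Rightarrow> real \<Rightarrow> real" where
  "Dx L v x = vector_derivative v (at x within {-L..L})"

definition Dxn :: "real \<Rightarrow> nat \<Rightarrow> (real \<Rightarrow> real) \<Rightarrow> real \<Rightarrow> real" where
  "Dxn L j v = (Dx L ^^ j) v"

definition C_space :: "real \<Rightarrow> nat \<Rightarrow> (real \<Rightarrow> real) set" where
  "C_space L s = {v. (\<forall>j<s. Dxn L j v differentiable_on {-L..L}) \<and>
                     continuous_on {-L..L} (Dxn L s v)}"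

definition C_norm :: "real \<Rightarrow> nat \<Rightarrow> (real \<Rightarrow> real) \<Rightarrow> real" where
  "C_norm L s v = (SUP j\<in>{0..s}. SUP x\<in>{-L..L}. \<bar>Dxn L j v x\<bar>)"

definition C0_space :: "real \<Rightarrow> nat \<Rightarrow> (real \<Rightarrow> real) set" where
  "C0_space L s = {w \<in> C_space L s.
     w (-L) = 0 \<and> w L = 0 \<and> Dxn L 2 w (-L) = 0 \<and> Dxn L 2 w L = 0}"

definition C0_tilde_space :: "real \<Rightarrow> nat \<Rightarrow> (real \<Rightarrow> real) set" where
  "C0_tilde_space L s = {v \<in> C_space L s. Dx L v (-L) = 0 \<and> Dx L v L = 0}"

text \<open>\<open>C(0,T;X)\<close> for a space \<open>X\<close> of functions with norm \<open>N\<close>. An element is a map taking a time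
  \<open>t\<close> to a function of \<open>x\<close>, so the value written \<open>v(x,t)\<close> in the literature is \<open>v t x\<close>.\<close>

definition C_time ::
  "real \<Rightarrow> (real \<Rightarrow> real) set \<Rightarrow> ((real \<Rightarrow> real) \<Rightarrow> real) \<Rightarrow> (real \<Rightarrow> real \<Rightarrow> real) set" where
  "C_time T X N = {v. (\<forall>t\<in>{0..T}. v t \<in> X) \<and>
     (\<forall>t\<in>{0..T}. ((\<lambda>s. N (\<lambda>x. v s x - v t x)) \<longlongrightarrow> 0) (at t within {0..T}))}"

definition green_kernel ::
  "real \<Rightarrow> real \<Rightarrow> (real \<Rightarrow> real) \<Rightarrow> (real \<Rightarrow> real) \<Rightarrow> real \<Rightarrow> real \<Rightarrow> real" where
  "green_kernel c W \<omega>1 \<omega>2 x \<xi> =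
     - (1 / (c * W)) * (if \<xi> \<le> x then \<omega>1 \<xi> * \<omega>2 x else \<omega>1 x * \<omega>2 \<xi>)"

definition F_green :: "real \<Rightarrow> real \<Rightarrow> real \<Rightarrow> real \<Rightarrow> real" where
  "F_green L b = green_kernel b (- (1 / sqrt b) * sinh (2 * L / sqrt b))
     (\<lambda>x. cosh ((L + x) / sqrt b)) (\<lambda>x. cosh ((L - x) / sqrt b))"

definition G_green :: "real \<Rightarrow> real \<Rightarrow> real \<Rightarrow> real \<Rightarrow> real" where
  "G_green L d = green_kernel d (- (1 / sqrt d) * sinh (2 * L / sqrt d))
     (\<lambda>x. sinh ((L + x) / sqrt d)) (\<lambda>x. sinh ((L - x) / sqrt d))"

text \<open>The kernels have a kink at \<open>\<xi> = x\<close>, where \<open>deriv\<close> is unspecified; this single point does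
  not affect the integrals.\<close>

definition L_N :: "real \<Rightarrow> real \<Rightarrow> (real \<Rightarrow> real) \<Rightarrow> real \<Rightarrow> real" where
  "L_N L b f x = integral {-L..L} (\<lambda>\<xi>. deriv (\<lambda>z. F_green L b x z) \<xi> * f \<xi>)"

definition L_D :: "real \<Rightarrow> real \<Rightarrow> (real \<Rightarrow> real) \<Rightarrow> real \<Rightarrow> real" where
  "L_D L d f x = integral {-L..L} (\<lambda>\<xi>. deriv (\<lambda>z. G_green L d x z) \<xi> * f \<xi>)"

text \<open>For \<open>\<eta>\<close>, \<open>u\<close> in the stated classes all integrands below are continuous in \<open>\<tau>\<close> at each
  fixed \<open>x\<close>, so the integrals never take the default value for non-integrable functions.\<close>

definition is_solution ::
  "real \<Rightarrow> real \<Rightarrow> real \<Rightarrow> real \<Rightarrow> nat \<Rightarrow> (real \<Rightarrow> real) \<Rightarrow> (real \<Rightarrow> real) \<Rightarrow> real \<Rightarrow>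
   (real \<Rightarrow> real \<Rightarrow> real) \<Rightarrow> (real \<Rightarrow> real \<Rightarrow> real) \<Rightarrow> bool" where
  "is_solution L a b d m \<eta>0 u0 T \<eta> u \<longleftrightarrow>
     \<eta> \<in> C_time T (C0_tilde_space L m) (C_norm L m) \<and>
     u \<in> C_time T (C0_space L (m + 1)) (C_norm L (m + 1)) \<and>
     (\<forall>t\<in>{0..T}. \<forall>x\<in>{-L..L}.
        \<eta> t x = \<eta>0 x + integral {0..t} (\<lambda>\<tau>.
            L_N L b (\<lambda>\<xi>. (a + b) / b * u \<tau> \<xi> + \<eta> \<tau> \<xi> * u \<tau> \<xi>) x + a / b * Dx L (u \<tau>) x) \<and>
        u t x = u0 x + integral {0..t} (\<lambda>\<tau>.
            L_D L d (\<lambda>\<xi>. \<eta> \<tau> \<xi> + 1 / 2 * (u \<tau> \<xi>)\<^sup>2) x))"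

end

theory Submission
  imports Defs
begin

text \<open>Both kernels are two-sided Volterra kernels, so \<open>L_N\<close> and \<open>L_D\<close> gain one derivative, and
  \<open>\<partial>\<^sub>x L_D g = g / d + (smoothing term)\<close>. Treating \<open>v = u\<^sub>x\<close> as a third unknown therefore turns the
  system into a fixed-point problem for \<open>(\<eta>, u, v)\<close> in the space of continuous functions, where a
  Picard iteration applies. Regularity is then propagated without shrinking \<open>T\<close>: pointwise in \<open>x\<close>,
  \<open>(\<eta>, v)\<close> solves the linear ODE \<open>\<eta>' = (a / b) v + g1\<close>, \<open>v' = \<eta> / d + g2\<close> with \<open>g1\<close>, \<open>g2\<close> one
  derivative smoother than \<open>(\<eta>, v)\<close>, and variation of constants gains one derivative per step until
  that of the data is reached. At \<open>x = L\<close> and \<open>x = -L\<close> the pair \<open>(\<eta>\<^sub>x, v\<^sub>x)\<close> solves the homogeneous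
  ODE with zero data, which preserves the boundary conditions. Conversely every solution of the
  original system yields a continuous solution of the extended one, whence uniqueness.\<close>

subsection \<open>A Picard theorem for non-local operators\<close>

text \<open>The obstacle is that the equations for \<open>\<eta>\<close> and \<open>v\<close> are
  coupled by the terms \<open>a / b * v\<close> and \<open>\<eta> / d\<close>, which are not
  smoothed: integrating in time gains nothing in \<open>x\<close>, so feeding regularity of the
  unknowns into the right-hand sides returns just the regularity put in. Variation of constants
  removes this coupling exactly. What remains on the right are the data, Green operators, which gain
  a derivative, and \<open>u\<^sup>2\<close>, where \<open>u\<close> is already one order ahead
  because its derivative is \<open>v\<close>. The signs \<open>a < 0\<close> and
  \<open>b, d > 0\<close> make the coupling a rotation of frequency
  \<open>sqrt (- a / (b * d))\<close>, hence sines and cosines. The local terms \<open>f / b\<close>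
  and \<open>f / d\<close> in the derivatives of the Green operators are the jumps of the
  differentiated kernels at the diagonal; their exact size is a Wronskian identity. The contraction
  takes place in the sup norm, so neither smoothness nor boundary conditions are built into the
  Picard space. Both are recovered afterwards, and the existence time depends only on sup-norm
  information.\<close>

lemma continuous_on_indefinite_integral_param:
  fixes f :: "real \<Rightarrow> 'a::topological_space \<Rightarrow> 'b::banach"
  assumes f: "continuous_on ({a..b} \<times> S) (\<lambda>(s, x). f s x)"
  shows "continuous_on ({a..b} \<times> S) (\<lambda>(t, x). integral {a..t} (\<lambda>s. f s x))"
proof -
  \<comment> \<open>The substitution \<open>s = a + r * (t - a)\<close> moves the variable upper
    limit into the integrand, leaving a parameter integral over the fixed interval
    \<open>[0, 1]\<close>. At \<open>t = a\<close> both sides are zero.\<close>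
  let ?g = "\<lambda>p r. f (a + r * (fst p - a)) (snd p)"
  have eq: "integral {a..t} (\<lambda>s. f s x) = (t - a) *\<^sub>R integral {0..1} (?g (t, x))"
    if "t \<in> {a..b}" "x \<in> S" for t x
  proof (cases "t = a")
    case False
    with that have ta: "t - a > 0" by auto
    have "continuous_on {a..t} (\<lambda>s. f s x)"
      by (rule continuous_on_compose2[OF f, of _ "\<lambda>s. (s, x)", simplified])
        (use that in \<open>auto intro!: continuous_intros\<close>)
    then have "((\<lambda>s. f s x) has_integral integral {a..t} (\<lambda>s. f s x)) (cbox a t)"
      by (auto intro!: integrable_integral integrable_continuous_real)
    from has_integral_affinity'[OF this ta, of a] ta
    have "((\<lambda>r. f ((t - a) * r + a) x) has_integral
        integral {a..t} (\<lambda>s. f s x) /\<^sub>R (t - a)) {0..1}"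
      by simp
    then have "integral {0..1} (\<lambda>r. f ((t - a) * r + a) x) = integral {a..t} (\<lambda>s. f s x) /\<^sub>R (t - a)"
      by (rule integral_unique)
    then show ?thesis using ta by (simp add: ac_simps)
  qed simp
  let ?h = "\<lambda>z. (a + snd z * (fst (fst z) - a), snd (fst z))"
  have "continuous_on (({a..b} \<times> S) \<times> {0..1}) ?h"
    by (intro continuous_intros)
  moreover have "?h ` (({a..b} \<times> S) \<times> {0..1}) \<subseteq> {a..b} \<times> S"
  proof safe
    fix t x r assume *: "t \<in> {a..b}" "r \<in> {0..(1::real)}"
    then have "0 \<le> r * (t - a)" "r * (t - a) \<le> t - a"
      by (auto intro!: mult_nonneg_nonneg mult_left_le_one_le)
    with * show "a + snd ((t, x), r) * (fst (fst ((t, x), r)) - a) \<in> {a..b}" by auto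
  qed auto
  ultimately have "continuous_on (({a..b} \<times> S) \<times> cbox 0 1) (\<lambda>(p, r). ?g p r)"
    using continuous_on_compose2[OF f, of _ ?h] by (simp add: split_def)
  from integral_continuous_on_param[OF this]
  have "continuous_on ({a..b} \<times> S) (\<lambda>p. integral {0..1} (?g p))" by simp
  then have "continuous_on ({a..b} \<times> S) (\<lambda>p. (fst p - a) *\<^sub>R integral {0..1} (?g p))"
    by (intro continuous_intros)
  then show ?thesis
    by (rule continuous_on_eq) (auto simp: eq)
qed

lemma continuous_on_slice1:
  assumes "continuous_on (A \<times> B) (\<lambda>(s, x). f s x)" "x \<in> B"
  shows "continuous_on A (\<lambda>s. f s x)"
  by (rule continuous_on_compose2[OF assms(1), of _ "\<lambda>s. (s, x)", simplified])
    (use assms(2) in \<open>auto intro!: continuous_intros\<close>)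

lemma continuous_on_slice2:
  assumes "continuous_on (A \<times> B) (\<lambda>(s, x). f s x)" "s \<in> A"
  shows "continuous_on B (f s)"
  by (rule continuous_on_compose2[OF assms(1), of _ "\<lambda>x. (s, x)", simplified])
    (use assms(2) in \<open>auto intro!: continuous_intros\<close>)

lemma continuous_on_compact_bound:
  fixes f :: "'a::topological_space \<Rightarrow> 'b::real_normed_vector"
  assumes "continuous_on K f" "compact K"
  obtains B where "B \<ge> 0" "\<And>x. x \<in> K \<Longrightarrow> norm (f x) \<le> B"
proof -
  have "bounded (f ` K)"
    by (rule compact_imp_bounded[OF compact_continuous_image[OF assms]])
  then obtain B where B: "B > 0" "\<And>y. y \<in> f ` K \<Longrightarrow> norm y \<le> B"
    by (meson bounded_pos)
  then show ?thesis by (intro that[of B]) auto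
qed

lemma norm_integral_le_mult:
  fixes f :: "real \<Rightarrow> 'b::real_normed_vector"
  assumes "0 \<le> B" "0 \<le> t" "f integrable_on {0..t}" "\<And>s. s \<in> {0..t} \<Longrightarrow> norm (f s) \<le> B"
  shows "norm (integral {0..t} f) \<le> B * t"
  using integrable_bound[of B f 0 t] assms by simp

text \<open>\<open>N\<close> takes a whole function of \<open>x\<close>, since the Green operators
  integrate over the interval, so a Lipschitz condition on point values would not do. The first
  clause lets \<open>N\<close> act at each time without losing joint continuity; the second is a
  Lipschitz bound on each sup-norm ball, with \<open>\<delta>\<close> standing for any bound on the
  distance of \<open>f\<close> and \<open>g\<close>.\<close>

definition nonlocal_Lipschitz :: "real \<Rightarrow> real \<Rightarrow> ((real \<Rightarrow> 'e::banach) \<Rightarrow> real \<Rightarrow> 'e) \<Rightarrow> bool" where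
  "nonlocal_Lipschitz l h N \<longleftrightarrow>
    (\<forall>(T::real) U. continuous_on ({0..T} \<times> {l..h}) (\<lambda>(t, x). U t x) \<longrightarrow>
       continuous_on ({0..T} \<times> {l..h}) (\<lambda>(t, x). N (U t) x)) \<and>
    (\<forall>R. \<exists>K\<ge>0. \<forall>f g \<delta>. continuous_on {l..h} f \<longrightarrow> continuous_on {l..h} g \<longrightarrow>
       (\<forall>x\<in>{l..h}. norm (f x) \<le> R \<and> norm (g x) \<le> R \<and> norm (f x - g x) \<le> \<delta>) \<longrightarrow>
       (\<forall>x\<in>{l..h}. norm (N f x - N g x) \<le> K * \<delta>))"

text \<open>The integral operator is a contraction on the closed unit ball around the initial value,
  extended constantly in time, within the complete space of bounded continuous functions.\<close>

lemma picard_exists: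
  fixes N :: "(real \<Rightarrow> 'e::banach) \<Rightarrow> real \<Rightarrow> 'e"
  assumes N: "nonlocal_Lipschitz l h N" and lh: "l \<le> h" and U0: "continuous_on {l..h} U0"
  shows "\<exists>T>(0::real). \<exists>U. continuous_on ({0..T} \<times> {l..h}) (\<lambda>(t, x). U t x) \<and>
    (\<forall>t\<in>{0..T}. \<forall>x\<in>{l..h}. U t x = U0 x + integral {0..t} (\<lambda>s. N (U s) x))"
proof -
  obtain R0 where R0: "R0 \<ge> 0" "\<And>x. x \<in> {l..h} \<Longrightarrow> norm (U0 x) \<le> R0"
    using continuous_on_compact_bound[OF U0] by auto
  \<comment> \<open>Functions within distance 1 of \<open>U0\<close> are bounded by
    \<open>R0 + 1\<close>, so this one Lipschitz constant serves the whole ball.\<close>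
  obtain K where K: "K \<ge> 0" and lip: "\<And>f g \<delta> x. \<lbrakk>continuous_on {l..h} f; continuous_on {l..h} g;
      \<And>x. x \<in> {l..h} \<Longrightarrow> norm (f x) \<le> R0 + 1 \<and> norm (g x) \<le> R0 + 1 \<and> norm (f x - g x) \<le> \<delta>;
      x \<in> {l..h}\<rbrakk> \<Longrightarrow> norm (N f x - N g x) \<le> K * \<delta>"
    using N unfolding nonlocal_Lipschitz_def by metis
  have cont: "continuous_on ({0..T} \<times> {l..h}) (\<lambda>(t, x). N (U t) x)"
    if "continuous_on ({0..T} \<times> {l..h}) (\<lambda>(t, x). U t x)" for T :: real and U
    using N that unfolding nonlocal_Lipschitz_def by blast
  have U0': "continuous_on (A \<times> {l..h}) (\<lambda>(t, x). U0 x)" for A :: "real set"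
    unfolding split_def by (rule continuous_on_compose2[OF U0]) (auto intro!: continuous_intros)
  have "continuous_on {l..h} (N U0)"
    by (rule continuous_on_slice2[OF cont[of 0 "\<lambda>t. U0", OF U0']]) simp
  then obtain B where B: "B \<ge> 0" "\<And>x. x \<in> {l..h} \<Longrightarrow> norm (N U0 x) \<le> B"
    using continuous_on_compact_bound by (metis compact_Icc)
  \<comment> \<open>On the ball, \<open>N\<close> is bounded by \<open>B + K\<close>:
    \<open>B\<close> bounds \<open>N U0\<close>, and \<open>K * 1\<close> bounds the deviation. Thus
    \<open>(B + K) * T \<le> 1\<close> keeps the ball invariant, and
    \<open>K * T \<le> 1 / 2\<close> gives contraction.\<close>
  define T where "T = 1 / (2 * (B + K + 1))"
  have T: "T > 0" using B(1) K by (simp add: T_def)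
  have TB: "(B + K) * T \<le> 1" "K * T \<le> 1 / 2"
    using B(1) K by (auto simp: T_def divide_simps)
  define Q where "Q = cbox (0::real, l) (T, h)"
  have Q: "Q = {0..T} \<times> {l..h}" by (simp add: Q_def cbox_Pair_eq)
  \<comment> \<open>Clamping to the rectangle \<open>Q\<close> extends a function continuous on
    \<open>Q\<close> to a bounded continuous function on the plane, without changing it on
    \<open>Q\<close>.\<close>
  define E where "E f = Bcontfun (ext_cont f (0::real, l) (T, h))" for f :: "real \<times> real \<Rightarrow> 'e"
  define cl where "cl = clamp (0::real, l) (T, h)"
  have cl: "cl p \<in> Q" for p
    using T lh by (auto simp: cl_def Q_def Basis_prod_def intro!: clamp_in_interval)
  have clQ: "cl p = p" if "p \<in> Q" for p
    using that by (auto simp: cl_def Q_def intro!: clamp_cancel_cbox)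
  have E: "apply_bcontfun (E f) p = f (cl p)" if "continuous_on Q f" for f p
  proof -
    have "ext_cont f (0::real, l) (T, h) \<in> bcontfun"
      using continuous_on_cbox_bcontfunE[OF that[unfolded Q_def]]
      by (metis apply_bcontfun ext_cont_def ext)
    then show ?thesis by (simp add: E_def Bcontfun_inverse ext_cont_def cl_def)
  qed
  define \<Phi> where "\<Phi> V = E (\<lambda>(t, x). U0 x + integral {0..t} (\<lambda>s. N (\<lambda>y. apply_bcontfun V (s, y)) x))" for V
  define S where "S = cball (E (\<lambda>(t, x). U0 x)) 1"
  have Vc: "continuous_on ({0..T} \<times> {l..h}) (\<lambda>(t, x). apply_bcontfun V (t, x))" for V
    by (simp add: split_def)
  have Vx: "continuous_on {l..h} (\<lambda>y. apply_bcontfun V (s, y))" for V s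
    by (rule continuous_on_compose2[of UNIV]) (auto intro!: continuous_intros)
  have NV: "continuous_on ({0..T} \<times> {l..h}) (\<lambda>(s, x). N (\<lambda>y. apply_bcontfun V (s, y)) x)" for V
    by (rule cont[OF Vc])
  have int: "(\<lambda>s. N (\<lambda>y. apply_bcontfun V (s, y)) x) integrable_on {0..t}"
    if "t \<in> {0..T}" "x \<in> {l..h}" for V t x
    by (rule integrable_continuous_real)
      (rule continuous_on_subset[OF continuous_on_slice1[OF NV]], use that in auto)
  have \<Phi>: "apply_bcontfun (\<Phi> V) p =
      U0 (snd (cl p)) + integral {0..fst (cl p)} (\<lambda>s. N (\<lambda>y. apply_bcontfun V (s, y)) (snd (cl p)))" for V p
    unfolding \<Phi>_def
  proof (subst E)
    show "continuous_on Q (\<lambda>(t, x). U0 x + integral {0..t} (\<lambda>s. N (\<lambda>y. apply_bcontfun V (s, y)) x))"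
      using continuous_on_add[OF U0' continuous_on_indefinite_integral_param[OF NV]]
      by (simp add: Q split_def)
  qed (simp add: split_def)
  have S: "norm (apply_bcontfun V (s, y) - U0 y) \<le> 1" "norm (apply_bcontfun V (s, y)) \<le> R0 + 1"
    if "V \<in> S" "s \<in> {0..T}" "y \<in> {l..h}" for V s y
  proof -
    have "apply_bcontfun (E (\<lambda>(t, x). U0 x)) (s, y) = U0 y"
      using that by (subst E) (auto simp: Q U0' clQ)
    then have "dist (U0 y) (apply_bcontfun V (s, y)) \<le> dist (E (\<lambda>(t, x). U0 x)) V"
      by (metis dist_bounded)
    then show *: "norm (apply_bcontfun V (s, y) - U0 y) \<le> 1"
      using that(1) by (simp add: S_def dist_norm norm_minus_commute)
    have "norm (apply_bcontfun V (s, y)) \<le> norm (U0 y) + norm (apply_bcontfun V (s, y) - U0 y)"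
      by (rule norm_triangle_sub)
    with * R0(2)[OF that(3)] show "norm (apply_bcontfun V (s, y)) \<le> R0 + 1" by linarith
  qed
  have fst_cl: "fst (cl p) \<in> {0..T}" "snd (cl p) \<in> {l..h}" for p
    using cl[of p] by (auto simp: Q mem_Times_iff)
  have "\<exists>!V\<in>S. \<Phi> V = V"
  proof (rule Banach_fix)
    show "complete S" by (simp add: S_def complete_eq_closed)
    show "S \<noteq> {}" by (simp add: S_def)
    show "\<Phi> ` S \<subseteq> S"
    proof safe
      fix V assume V: "V \<in> S"
      have "dist (apply_bcontfun (E (\<lambda>(t, x). U0 x)) p) (apply_bcontfun (\<Phi> V) p) \<le> 1" for p
      proof -
        define t x where "t = fst (cl p)" and "x = snd (cl p)"
        have tx: "t \<in> {0..T}" "x \<in> {l..h}" using fst_cl by (auto simp: t_def x_def)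
        have "norm (integral ({0..t}) (\<lambda>s. N (\<lambda>y. apply_bcontfun V (s, y)) x)) \<le> (B + K) * t"
        proof (rule norm_integral_le_mult)
          show "0 \<le> B + K" "0 \<le> t" using B K tx by simp_all
          show "(\<lambda>s. N (\<lambda>y. apply_bcontfun V (s, y)) x) integrable_on {0..t}"
            using int[OF tx] by simp
          fix s assume s: "s \<in> {0..t}"
          have "norm (N (\<lambda>y. apply_bcontfun V (s, y)) x - N U0 x) \<le> K * 1"
            using S[OF V] s tx order_trans[OF R0(2), of _ "R0 + 1"] by (intro lip Vx U0) auto
          then show "norm (N (\<lambda>y. apply_bcontfun V (s, y)) x) \<le> B + K"
            using B(2)[OF tx(2)] norm_triangle_sub[of "N (\<lambda>y. apply_bcontfun V (s, y)) x" "N U0 x"]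
            by linarith
        qed
        also have "\<dots> \<le> (B + K) * T" using tx B K by (auto intro!: mult_left_mono)
        finally show ?thesis using TB
          U0'[of "{0..T}"] by (subst E) (auto simp: Q \<Phi> t_def x_def split_def dist_norm)
      qed
      then show "\<Phi> V \<in> S" by (auto simp: S_def intro!: dist_bound)
    qed
    show "dist (\<Phi> V) (\<Phi> V') \<le> 1 / 2 * dist V V'" if V: "V \<in> S" "V' \<in> S" for V V'
    proof (rule dist_bound)
      fix p
      define t x where "t = fst (cl p)" and "x = snd (cl p)"
      have tx: "t \<in> {0..T}" "x \<in> {l..h}" using fst_cl by (auto simp: t_def x_def)
      have "norm (integral ({0..t}) (\<lambda>s. N (\<lambda>y. apply_bcontfun V (s, y)) x - N (\<lambda>y. apply_bcontfun V' (s, y)) x))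
          \<le> (K * dist V V') * t"
      proof (rule norm_integral_le_mult)
        show "0 \<le> K * dist V V'" "0 \<le> t" using K tx by simp_all
        show "(\<lambda>s. N (\<lambda>y. apply_bcontfun V (s, y)) x - N (\<lambda>y. apply_bcontfun V' (s, y)) x) integrable_on {0..t}"
          using int[OF tx] by (auto intro!: integrable_diff)
        fix s assume s: "s \<in> {0..t}"
        show "norm (N (\<lambda>y. apply_bcontfun V (s, y)) x - N (\<lambda>y. apply_bcontfun V' (s, y)) x) \<le> K * dist V V'"
          using S(2)[OF V(1)] S(2)[OF V(2)] s tx
          by (intro lip Vx) (auto simp: dist_norm[symmetric] dist_bounded)
      qed
      also have "\<dots> = (K * t) * dist V V'" using tx by simp
      also have "\<dots> \<le> 1 / 2 * dist V V'"
        using TB(2) tx mult_left_mono[of t T K] K by (intro mult_right_mono) auto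
      finally show "dist (apply_bcontfun (\<Phi> V) p) (apply_bcontfun (\<Phi> V') p) \<le> 1 / 2 * dist V V'"
        using int[OF tx] by (simp add: \<Phi> dist_norm t_def x_def integral_diff)
    qed
  qed auto
  then obtain V where V: "\<Phi> V = V" by blast
  have "apply_bcontfun V (t, x) = U0 x + integral {0..t} (\<lambda>s. N (\<lambda>y. apply_bcontfun V (s, y)) x)"
    if "t \<in> {0..T}" "x \<in> {l..h}" for t x
    using \<Phi>[of V "(t, x)"] that by (simp add: V clQ Q)
  with Vc[of V] have "continuous_on ({0..T} \<times> {l..h}) (\<lambda>(t, x). apply_bcontfun V (t, x)) \<and>
      (\<forall>t\<in>{0..T}. \<forall>x\<in>{l..h}. apply_bcontfun V (t, x) =
        U0 x + integral {0..t} (\<lambda>s. N (\<lambda>y. apply_bcontfun V (s, y)) x))" by blast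
  then show ?thesis
    by (intro exI[of _ T] conjI[OF T] exI[of _ "\<lambda>t x. apply_bcontfun V (t, x)"])
qed

text \<open>The induction step of \<open>picard_unique\<close>: integrating \<open>K\<close> times
  the \<open>n\<close>-th bound yields the next one.\<close>

lemma integral_power_div_fact:
  assumes "0 \<le> (t::real)"
  shows "((\<lambda>s. c * K * (K * s) ^ n / fact n) has_integral c * (K * t) ^ Suc n / fact (Suc n)) {0..t}"
proof -
  have "((\<lambda>s. c * (K * s) ^ Suc n / fact (Suc n)) has_vector_derivative c * K * (K * s) ^ n / fact n)
      (at s within {0..t})" for s
  proof -
    have "((\<lambda>s. (K * s) ^ Suc n) has_real_derivative real (Suc n) * (K * s) ^ n * K) (at s within {0..t})"
      by (rule derivative_eq_intros refl | simp)+
    from DERIV_cmult[OF this, of "c / fact (Suc n)"] show ?thesis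
      unfolding has_real_derivative_iff_has_vector_derivative[symmetric]
      by (rule DERIV_cong[THEN iffD1[OF arg_cong[of _ _ "\<lambda>f. (f has_real_derivative _) _"], rotated]])
        (simp_all add: field_simps del: power_Suc of_nat_Suc)
  qed
  from fundamental_theorem_of_calculus[OF assms this] show ?thesis by simp
qed

text \<open>The contraction only gives uniqueness within its ball. Here two arbitrary solutions on
  any \<open>[0, T]\<close> are compared: both are bounded by some \<open>R\<close> by compactness,
  and iterating the Lipschitz estimate \<open>n\<close> times bounds their difference by
  \<open>2 * R * (K * t) ^ n / fact n\<close>, which tends to 0 without smallness of
  \<open>T\<close>.\<close>

lemma picard_unique:
  fixes N :: "(real \<Rightarrow> 'e::banach) \<Rightarrow> real \<Rightarrow> 'e" and T :: real
  assumes N: "nonlocal_Lipschitz l h N"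
    and U: "continuous_on ({0..T} \<times> {l..h}) (\<lambda>(t, x). U t x)"
      "\<And>t x. t \<in> {0..T} \<Longrightarrow> x \<in> {l..h} \<Longrightarrow> U t x = U0 x + integral {0..t} (\<lambda>s. N (U s) x)"
    and V: "continuous_on ({0..T} \<times> {l..h}) (\<lambda>(t, x). V t x)"
      "\<And>t x. t \<in> {0..T} \<Longrightarrow> x \<in> {l..h} \<Longrightarrow> V t x = U0 x + integral {0..t} (\<lambda>s. N (V s) x)"
    and tx: "t \<in> {0..T}" "x \<in> {l..h}"
  shows "U t x = V t x"
proof -
  have cp: "compact ({0..T} \<times> {l..h})" by (intro compact_Times compact_Icc)
  obtain R1 where R1: "\<And>p. p \<in> {0..T} \<times> {l..h} \<Longrightarrow> norm (case p of (t, x) \<Rightarrow> U t x) \<le> R1"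
    using continuous_on_compact_bound[OF U(1) cp] by blast
  obtain R2 where R2: "\<And>p. p \<in> {0..T} \<times> {l..h} \<Longrightarrow> norm (case p of (t, x) \<Rightarrow> V t x) \<le> R2"
    using continuous_on_compact_bound[OF V(1) cp] by blast
  define R where "R = max R1 R2"
  have R: "norm (U t x) \<le> R" "norm (V t x) \<le> R" if "t \<in> {0..T}" "x \<in> {l..h}" for t x
    using R1[of "(t, x)"] R2[of "(t, x)"] that by (auto simp: R_def)
  obtain K where K: "K \<ge> 0" and lip: "\<And>f g \<delta> x. \<lbrakk>continuous_on {l..h} f; continuous_on {l..h} g;
      \<And>x. x \<in> {l..h} \<Longrightarrow> norm (f x) \<le> R \<and> norm (g x) \<le> R \<and> norm (f x - g x) \<le> \<delta>;
      x \<in> {l..h}\<rbrakk> \<Longrightarrow> norm (N f x - N g x) \<le> K * \<delta>"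
    using N unfolding nonlocal_Lipschitz_def by metis
  have NU: "continuous_on ({0..T} \<times> {l..h}) (\<lambda>(t, x). N (U t) x)"
    and NV: "continuous_on ({0..T} \<times> {l..h}) (\<lambda>(t, x). N (V t) x)"
    using N U(1) V(1) unfolding nonlocal_Lipschitz_def by blast+
  have bound: "norm (U t x - V t x) \<le> (2 * R) * (K * t) ^ n / fact n"
    if "t \<in> {0..T}" "x \<in> {l..h}" for n t x
    using that
  proof (induction n arbitrary: t x)
    case 0
    then show ?case using R[of t x] norm_triangle_ineq4[of "U t x" "V t x"] by simp
  next
    case (Suc n)
    have i: "(\<lambda>s. N (U s) x) integrable_on {0..t}" "(\<lambda>s. N (V s) x) integrable_on {0..t}"
      using Suc.prems
      by (auto intro!: integrable_continuous_real continuous_on_subset[OF continuous_on_slice1[OF NU]]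
        continuous_on_subset[OF continuous_on_slice1[OF NV]])
    have "norm (integral {0..t} (\<lambda>s. N (U s) x - N (V s) x))
      \<le> integral {0..t} (\<lambda>s. (2 * R) * K * (K * s) ^ n / fact n)"
    proof (rule integral_norm_bound_integral)
      show "(\<lambda>s. N (U s) x - N (V s) x) integrable_on {0..t}" using i by (rule integrable_diff)
      show "(\<lambda>s. (2 * R) * K * (K * s) ^ n / fact n) integrable_on {0..t}"
        using integral_power_div_fact[of t] Suc.prems by (auto simp: has_integral_iff)
      fix s assume s: "s \<in> {0..t}"
      then have s': "s \<in> {0..T}" using Suc.prems by auto
      have "norm (N (U s) x - N (V s) x) \<le> K * ((2 * R) * (K * s) ^ n / fact n)"
        using s' Suc.prems R Suc.IH
        by (intro lip continuous_on_slice2[OF U(1)] continuous_on_slice2[OF V(1)]) auto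
      then show "norm (N (U s) x - N (V s) x) \<le> (2 * R) * K * (K * s) ^ n / fact n"
        by (simp add: ac_simps)
    qed
    also have "\<dots> = (2 * R) * (K * t) ^ Suc n / fact (Suc n)"
      using integral_power_div_fact[of t] Suc.prems by (intro integral_unique) auto
    finally show ?case using Suc.prems i by (simp add: U(2)[of t x] V(2)[of t x] integral_diff)
  qed
  have "(\<lambda>n. (2 * R) * ((K * t) ^ n / fact n)) \<longlonglongrightarrow> (2 * R) * 0"
    by (intro tendsto_intros summable_LIMSEQ_zero)
      (use summable_exp[of "K * t"] in \<open>simp add: field_simps\<close>)
  then have "norm (U t x - V t x) \<le> (2 * R) * 0"
    by (rule LIMSEQ_le_const) (use bound[OF tx] in auto)
  then show ?thesis by simp
qed

subsection \<open>Joint regularity in space and time\<close>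

text \<open>A calculus for \<open>C(0,T;C^k)\<close> without norms: all \<open>x\<close>-derivatives
  up to order \<open>k\<close> exist and are continuous in \<open>(t, x)\<close>, while in time
  nothing beyond continuity is asked. On a compact rectangle this matches continuity in time with
  values in \<open>C^k\<close>; the link is made by \<open>jointly_C_imp_C_time\<close> and
  \<open>C_time_continuous_Dxn\<close>.\<close>

primrec jointly_C :: "real \<Rightarrow> real \<Rightarrow> nat \<Rightarrow> (real \<Rightarrow> real \<Rightarrow> real) \<Rightarrow> bool" where
  "jointly_C T L 0 f \<longleftrightarrow> continuous_on ({0..T} \<times> {-L..L}) (\<lambda>(t, x). f t x)"
| "jointly_C T L (Suc k) f \<longleftrightarrow> continuous_on ({0..T} \<times> {-L..L}) (\<lambda>(t, x). f t x) \<and>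
    (\<exists>g. jointly_C T L k g \<and>
      (\<forall>t\<in>{0..T}. \<forall>x\<in>{-L..L}. (f t has_real_derivative g t x) (at x within {-L..L})))"

lemma jointly_C_continuous:
  "jointly_C T L k f \<Longrightarrow> continuous_on ({0..T} \<times> {-L..L}) (\<lambda>(t, x). f t x)"
  by (cases k) auto

lemma jointly_C_SucI:
  assumes "jointly_C T L k f" "jointly_C T L k g"
    "\<And>t x. t \<in> {0..T} \<Longrightarrow> x \<in> {-L..L} \<Longrightarrow> (f t has_real_derivative g t x) (at x within {-L..L})"
  shows "jointly_C T L (Suc k) f"
  using assms jointly_C_continuous[OF assms(1)] by auto

lemma jointly_C_SucD: "jointly_C T L (Suc k) f \<Longrightarrow> jointly_C T L k f"
proof (induction k arbitrary: f)
  case (Suc k)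
  then obtain g where "jointly_C T L (Suc k) g"
    "\<forall>t\<in>{0..T}. \<forall>x\<in>{-L..L}. (f t has_real_derivative g t x) (at x within {-L..L})"
    by auto
  with Suc.IH[of g] Suc.prems show ?case by auto
qed simp

lemma jointly_C_mono: "jointly_C T L k f \<Longrightarrow> j \<le> k \<Longrightarrow> jointly_C T L j f"
  by (induction k) (auto simp: le_Suc_eq dest: jointly_C_SucD simp del: jointly_C.simps)

lemma has_real_derivative_within_cong:
  assumes "\<And>x. x \<in> S \<Longrightarrow> f x = g x" "x \<in> S"
  shows "(f has_real_derivative D) (at x within S) \<longleftrightarrow> (g has_real_derivative D) (at x within S)"
  using assms by (auto intro: has_field_derivative_transform_within[of _ _ _ _ 1])

lemma jointly_C_cong:
  assumes "\<And>t x. t \<in> {0..T} \<Longrightarrow> x \<in> {-L..L} \<Longrightarrow> f t x = g t x"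
  shows "jointly_C T L k f \<longleftrightarrow> jointly_C T L k g"
proof -
  have *: "jointly_C T L k g"
    if "jointly_C T L k f" "\<And>t x. t \<in> {0..T} \<Longrightarrow> x \<in> {-L..L} \<Longrightarrow> f t x = g t x" for f g
  proof -
    have "continuous_on ({0..T} \<times> {-L..L}) (\<lambda>(t, x). g t x)"
      using jointly_C_continuous[OF that(1)] by (rule continuous_on_eq) (use that(2) in auto)
    moreover have "(g t has_real_derivative h t x) (at x within {-L..L})"
      if "t \<in> {0..T}" "x \<in> {-L..L}"
        "\<forall>t\<in>{0..T}. \<forall>x\<in>{-L..L}. (f t has_real_derivative h t x) (at x within {-L..L})" for h t x
      using has_real_derivative_within_cong[of "{-L..L}" "f t" "g t" x] that
        \<open>\<And>t x. t \<in> {0..T} \<Longrightarrow> x \<in> {-L..L} \<Longrightarrow> f t x = g t x\<close> by blast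
    ultimately show ?thesis using that(1) by (cases k) auto
  qed
  show ?thesis using *[of f g] *[of g f] assms by auto
qed

lemma jointly_C_time:
  assumes "continuous_on {0..T} \<phi>"
  shows "jointly_C T L k (\<lambda>t x. \<phi> t)"
proof -
  have z: "jointly_C T L k (\<lambda>t x. 0)" for k
    by (induction k) (auto intro!: exI[of _ "\<lambda>t x. 0"] simp: split_def)
  have "continuous_on ({0..T} \<times> {-L..L}) (\<lambda>(t, x). \<phi> t)"
    unfolding split_def by (rule continuous_on_compose2[OF assms]) (auto intro!: continuous_intros)
  then show ?thesis using z by (cases k) (auto intro!: exI[of _ "\<lambda>t x. 0"])
qed

lemma jointly_C_add:
  "jointly_C T L k f \<Longrightarrow> jointly_C T L k g \<Longrightarrow> jointly_C T L k (\<lambda>t x. f t x + g t x)"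
proof (induction k arbitrary: f g)
  case 0
  then show ?case by (auto simp: split_def intro!: continuous_intros)
next
  case (Suc k)
  obtain f' g' where d: "jointly_C T L k f'" "jointly_C T L k g'"
    "\<forall>t\<in>{0..T}. \<forall>x\<in>{-L..L}. (f t has_real_derivative f' t x) (at x within {-L..L})"
    "\<forall>t\<in>{0..T}. \<forall>x\<in>{-L..L}. (g t has_real_derivative g' t x) (at x within {-L..L})"
    using Suc.prems by auto
  show ?case
    by (rule jointly_C_SucI[OF Suc.IH[OF Suc.prems[THEN jointly_C_SucD]] Suc.IH[OF d(1,2)]])
      (use d in \<open>auto intro!: DERIV_add\<close>)
qed

lemma jointly_C_mult:
  "jointly_C T L k f \<Longrightarrow> jointly_C T L k g \<Longrightarrow> jointly_C T L k (\<lambda>t x. f t x * g t x)"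
proof (induction k arbitrary: f g)
  case 0
  then show ?case by (auto simp: split_def intro!: continuous_intros)
next
  case (Suc k)
  obtain f' g' where d: "jointly_C T L k f'" "jointly_C T L k g'"
    "\<forall>t\<in>{0..T}. \<forall>x\<in>{-L..L}. (f t has_real_derivative f' t x) (at x within {-L..L})"
    "\<forall>t\<in>{0..T}. \<forall>x\<in>{-L..L}. (g t has_real_derivative g' t x) (at x within {-L..L})"
    using Suc.prems by auto
  note fg = Suc.prems[THEN jointly_C_SucD]
  show ?case
    by (rule jointly_C_SucI[OF Suc.IH[OF fg] jointly_C_add[OF Suc.IH[OF d(1) fg(2)] Suc.IH[OF d(2) fg(1)]]])
      (use d in \<open>auto intro!: DERIV_mult\<close>)
qed

lemma jointly_C_const: "jointly_C T L k (\<lambda>t x. c)"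
  by (rule jointly_C_time) simp

lemma jointly_C_cmult: "jointly_C T L k f \<Longrightarrow> jointly_C T L k (\<lambda>t x. c * f t x)"
  by (rule jointly_C_mult[OF jointly_C_const])

lemma jointly_C_diff:
  assumes "jointly_C T L k f" "jointly_C T L k g"
  shows "jointly_C T L k (\<lambda>t x. f t x - g t x)"
  using jointly_C_add[OF assms(1) jointly_C_cmult[OF assms(2), of "-1"]] by simp

text \<open>Both claims are proved in one induction because each function is, up to the factor
  \<open>p\<close>, the derivative of the other.\<close>

lemma jointly_C_cosh_sinh:
  "jointly_C T L k (\<lambda>t x. cosh (p * x + q)) \<and> jointly_C T L k (\<lambda>t x. sinh (p * x + q))"
proof (induction k)
  case 0
  show ?case by (auto simp: split_def intro!: continuous_intros)
next
  case (Suc k)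
  then have i: "jointly_C T L k (\<lambda>t x. cosh (p * x + q))" "jointly_C T L k (\<lambda>t x. sinh (p * x + q))"
    by auto
  have "((\<lambda>x. cosh (p * x + q)) has_real_derivative p * sinh (p * x + q)) (at x within {-L..L})"
    "((\<lambda>x. sinh (p * x + q)) has_real_derivative p * cosh (p * x + q)) (at x within {-L..L})" for x
    by (auto intro!: derivative_eq_intros)
  with i show ?case
    using jointly_C_SucI[OF i(1) jointly_C_cmult[OF i(2), of p]]
      jointly_C_SucI[OF i(2) jointly_C_cmult[OF i(1), of p]] by blast
qed

lemma continuous_on_swap_Times:
  assumes "continuous_on (A \<times> B) (\<lambda>(s, x). f s x)"
  shows "continuous_on (B \<times> A) (\<lambda>(x, s). f s x)"
  using continuous_on_compose2[OF assms, of "B \<times> A" prod.swap] continuous_on_swap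
  by (force simp: split_def prod.swap_def)

lemma continuous_on_antiderivative_param:
  fixes f :: "real \<Rightarrow> real \<Rightarrow> real"
  assumes "continuous_on ({0..T} \<times> {-L..L}) (\<lambda>(t, x). f t x)"
  shows "continuous_on ({0..T} \<times> {-L..L}) (\<lambda>(t, x). integral {-L..x} (f t))"
  using continuous_on_swap_Times[OF continuous_on_indefinite_integral_param[where f = "\<lambda>x t. f t x",
      OF continuous_on_swap_Times[OF assms]]]
  by simp

text \<open>The source of all smoothing: a Green operator is a combination of such antiderivatives
  with smooth weights.\<close>

lemma jointly_C_antiderivative:
  assumes "jointly_C T L k f"
  shows "jointly_C T L (Suc k) (\<lambda>t x. integral {-L..x} (f t))"
  using assms continuous_on_antiderivative_param[OF jointly_C_continuous[OF assms]]
    continuous_on_slice2[OF jointly_C_continuous[OF assms]]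
  by (auto intro!: exI[of _ f] integral_has_real_derivative)

text \<open>The integral over all of \<open>[-L, L]\<close> depends on \<open>t\<close> alone, and
  subtracting the antiderivative from \<open>-L\<close> leaves the one up to
  \<open>L\<close>.\<close>

lemma jointly_C_antiderivative':
  assumes "jointly_C T L k f"
  shows "jointly_C T L (Suc k) (\<lambda>t x. integral {x..L} (f t))"
proof -
  note c = jointly_C_continuous[OF assms]
  have eq: "integral {x..L} (f t) = integral {-L..L} (f t) - integral {-L..x} (f t)"
    if "t \<in> {0..T}" "x \<in> {-L..L}" for t x
    using Henstock_Kurzweil_Integration.integral_combine[of "-L" x L "f t"] that
      integrable_continuous_real[OF continuous_on_slice2[OF c that(1)]] by simp
  have "continuous_on {0..T} (\<lambda>t. integral (cbox (-L) L) (f t))"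
    by (rule integral_continuous_on_param) (use c in simp)
  then have "jointly_C T L (Suc k) (\<lambda>t x. integral {-L..L} (f t) - integral {-L..x} (f t))"
    by (intro jointly_C_diff jointly_C_time jointly_C_antiderivative assms) auto
  then show ?thesis
    by (rule jointly_C_cong[THEN iffD1, rotated]) (rule eq[symmetric])
qed

lemma DERIV_time_integral:
  fixes f g :: "real \<Rightarrow> real \<Rightarrow> real"
  assumes f: "continuous_on ({0..T} \<times> {-L..L}) (\<lambda>(t, x). f t x)"
    and g: "continuous_on ({0..T} \<times> {-L..L}) (\<lambda>(t, x). g t x)"
    and d: "\<And>t x. t \<in> {0..T} \<Longrightarrow> x \<in> {-L..L} \<Longrightarrow> (f t has_real_derivative g t x) (at x within {-L..L})"
    and tx: "t \<in> {0..T}" "x \<in> {-L..L}"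
  shows "((\<lambda>x. integral {0..t} (\<lambda>s. f s x)) has_real_derivative integral {0..t} (\<lambda>s. g s x))
    (at x within {-L..L})"
proof -
  have "((\<lambda>x. integral {0..t} (\<lambda>s. f s x)) has_real_derivative integral {0..t} (\<lambda>s. g s x))
    (at x within {-L..L})"
  proof (rule leibniz_rule_field_derivative[where a = "0::real" and b = t, unfolded cbox_interval])
    show "continuous_on ({- L..L} \<times> {0..t}) (\<lambda>(x, s). g s x)"
      by (rule continuous_on_swap_Times, rule continuous_on_subset[OF g]) (use tx in auto)
    show "(\<lambda>s. f s y) integrable_on {0..t}" if "y \<in> {-L..L}" for y
      by (rule integrable_continuous_real, rule continuous_on_subset[OF continuous_on_slice1[OF f that]])
        (use tx in auto)
  qed (use d tx in auto)
  then show ?thesis by simp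
qed

text \<open>In contrast to integration in \<open>x\<close>, regularity is preserved but not
  raised.\<close>

lemma jointly_C_time_integral:
  "jointly_C T L k f \<Longrightarrow> jointly_C T L k (\<lambda>t x. integral {0..t} (\<lambda>s. f s x))"
proof (induction k arbitrary: f)
  case 0
  then show ?case using continuous_on_indefinite_integral_param by simp
next
  case (Suc k)
  obtain g where g: "jointly_C T L k g"
    "\<forall>t\<in>{0..T}. \<forall>x\<in>{-L..L}. (f t has_real_derivative g t x) (at x within {-L..L})"
    using Suc.prems by auto
  show ?case
    by (rule jointly_C_SucI[OF Suc.IH[OF jointly_C_SucD[OF Suc.prems]] Suc.IH[OF g(1)]],
        rule DERIV_time_integral[OF jointly_C_continuous[OF Suc.prems] jointly_C_continuous[OF g(1)]])
      (use g in auto)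
qed

section \<open>Derivatives within the interval and the spaces \<open>C^s\<close>\<close>

lemma Dx_eqI:
  assumes "L > 0" "x \<in> {-L..L}" "(f has_real_derivative D) (at x within {-L..L})"
  shows "Dx L f x = D"
  unfolding Dx_def using assms
  by (intro vector_derivative_within_closed_interval)
    (auto simp: has_real_derivative_iff_has_vector_derivative)

text \<open>True even where no derivative exists: \<open>f\<close> and \<open>g\<close> have the
  same set of derivatives at \<open>x\<close>, so \<open>vector_derivative\<close> makes the same
  choice for both.\<close>

lemma Dx_cong:
  assumes "\<And>x. x \<in> {-L..L} \<Longrightarrow> f x = g x" "x \<in> {-L..L}"
  shows "Dx L f x = Dx L g x"
  using has_real_derivative_within_cong[of "{-L..L}" f g x] assms
  by (simp add: Dx_def vector_derivative_def has_real_derivative_iff_has_vector_derivative)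

lemma Dxn_0 [simp]: "Dxn L 0 f = f"
  by (simp add: Dxn_def)

lemma Dxn_Suc: "Dxn L (Suc j) f = Dx L (Dxn L j f)"
  by (simp add: Dxn_def)

lemma Dxn_Suc': "Dxn L (Suc j) f = Dxn L j (Dx L f)"
  by (simp add: Dxn_def funpow_swap1)

lemma Dxn_cong:
  assumes "\<And>x. x \<in> {-L..L} \<Longrightarrow> f x = g x" "x \<in> {-L..L}"
  shows "Dxn L j f x = Dxn L j g x"
  using assms by (induction j arbitrary: x) (auto simp: Dxn_Suc intro!: Dx_cong)

text \<open>With \<open>C_space_SucI\<close>, this replaces the definition through all orders by a
  recursion on the first derivative, the form in which \<open>jointly_C\<close> is built.\<close>

lemma C_space_Suc:
  assumes "f \<in> C_space L (Suc k)"
  shows "Dx L f \<in> C_space L k" "continuous_on {-L..L} f"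
    "x \<in> {-L..L} \<Longrightarrow> (f has_real_derivative Dx L f x) (at x within {-L..L})"
proof -
  show "Dx L f \<in> C_space L k"
    using assms unfolding C_space_def by (auto simp flip: Dxn_Suc')
  have d: "f differentiable_on {-L..L}"
    using assms unfolding C_space_def by (auto dest: spec[of _ 0])
  then show "continuous_on {-L..L} f" by (rule differentiable_imp_continuous_on)
  show "(f has_real_derivative Dx L f x) (at x within {-L..L})" if "x \<in> {-L..L}"
    using d that
    by (auto simp: Dx_def differentiable_on_def has_real_derivative_iff_has_vector_derivative
        vector_derivative_works)
qed

lemma C_space_continuous: "f \<in> C_space L k \<Longrightarrow> continuous_on {-L..L} f"
  by (cases k) (auto dest: C_space_Suc simp: C_space_def[of L 0])

lemma continuous_on_const_time:
  "continuous_on X f \<Longrightarrow> continuous_on (A \<times> X) (\<lambda>(t, x). f x)"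
  unfolding split_def by (rule continuous_on_compose2) (auto intro!: continuous_intros)

lemma jointly_C_of_C_space: "f \<in> C_space L k \<Longrightarrow> jointly_C T L k (\<lambda>t. f)"
proof (induction k arbitrary: f)
  case 0
  then have "continuous_on {-L..L} f" by (rule C_space_continuous)
  then show ?case by (simp add: continuous_on_const_time)
next
  case (Suc k)
  from continuous_on_const_time[OF C_space_continuous[OF Suc.prems]]
    Suc.IH[OF C_space_Suc(1)[OF Suc.prems]] C_space_Suc(3)[OF Suc.prems]
  show ?case by auto
qed

lemma C_space_cong:
  assumes "\<And>x. x \<in> {-L..L} \<Longrightarrow> f x = g x" "f \<in> C_space L k"
  shows "g \<in> C_space L k"
proof -
  have D: "Dxn L j f x = Dxn L j g x" if "x \<in> {-L..L}" for j x
    using Dxn_cong that assms(1) by blast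
  have "continuous_on {-L..L} (Dxn L k g)"
    by (rule continuous_on_eq[OF _ D]) (use assms(2) in \<open>simp_all add: C_space_def\<close>)
  moreover have "Dxn L j g differentiable_on {-L..L}" if "j < k" for j
    unfolding differentiable_on_def
  proof
    fix x assume "x \<in> {-L..L}"
    with assms(2) that show "Dxn L j g differentiable at x within {-L..L}"
      by (intro differentiable_transform_within[where f = "Dxn L j f" and d = 1, OF _ _ _ D])
        (auto simp: C_space_def differentiable_on_def)
  qed
  ultimately show ?thesis by (auto simp: C_space_def)
qed

lemma C_space_SucI:
  assumes L: "L > 0" and f: "\<And>x. x \<in> {-L..L} \<Longrightarrow> (f has_real_derivative g x) (at x within {-L..L})"
    and g: "g \<in> C_space L k"
  shows "f \<in> C_space L (Suc k)"
proof -
  have "Dx L f \<in> C_space L k"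
    using g by (rule C_space_cong[rotated]) (use L f in \<open>auto intro!: Dx_eqI[symmetric]\<close>)
  moreover have "f differentiable_on {-L..L}"
    using f unfolding differentiable_on_def real_differentiable_def by blast
  ultimately show ?thesis
    by (auto simp: C_space_def Dxn_Suc' less_Suc_eq_0_disj)
qed

text \<open>Uniqueness of derivatives on a nondegenerate interval identifies the existential
  witnesses inside \<open>jointly_C\<close> with the iterates of \<open>Dx\<close>.\<close>

lemma jointly_C_imp:
  assumes "L > 0"
  shows "jointly_C T L k f \<Longrightarrow> (\<forall>t\<in>{0..T}. f t \<in> C_space L k) \<and>
    (\<forall>j\<le>k. jointly_C T L (k - j) (\<lambda>t. Dxn L j (f t)))"
proof (induction k arbitrary: f)
  case 0
  then show ?case by (auto simp: C_space_def intro: continuous_on_slice2)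
next
  case (Suc k)
  obtain g where g: "jointly_C T L k g"
    "\<And>t x. t \<in> {0..T} \<Longrightarrow> x \<in> {-L..L} \<Longrightarrow> (f t has_real_derivative g t x) (at x within {-L..L})"
    using Suc.prems by auto
  have "jointly_C T L (Suc k - j) (\<lambda>t. Dxn L j (f t))" if "j \<le> Suc k" for j
  proof (cases j)
    case (Suc i)
    have "jointly_C T L (k - i) (\<lambda>t. Dxn L i (g t))" using Suc.IH[OF g(1)] Suc that by auto
    moreover have "Dxn L i (g t) x = Dxn L (Suc i) (f t) x" if "t \<in> {0..T}" "x \<in> {-L..L}" for t x
      unfolding Dxn_Suc' by (rule Dxn_cong) (use that g \<open>L > 0\<close> in \<open>auto intro!: Dx_eqI[symmetric]\<close>)
    ultimately show ?thesis unfolding Suc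
      by (subst jointly_C_cong[of _ _ _ "\<lambda>t. Dxn L i (g t)"]) auto
  qed (use Suc.prems in simp)
  moreover have "f t \<in> C_space L (Suc k)" if "t \<in> {0..T}" for t
    using Suc.IH[OF g(1)] g(2) that by (intro C_space_SucI[OF \<open>L > 0\<close>]) auto
  ultimately show ?case by blast
qed

text \<open>\<open>C_time\<close> measures \<open>f s - f t\<close>, so \<open>Dxn\<close> has to be
  split over a difference. Both functions must lie in \<open>C^k\<close>, since \<open>Dx\<close> is
  unspecified where no derivative exists.\<close>

lemma C_space_diff:
  assumes L: "L > 0"
  shows "f \<in> C_space L k \<Longrightarrow> g \<in> C_space L k \<Longrightarrow> (\<lambda>x. f x - g x) \<in> C_space L k \<and>
    (\<forall>j\<le>k. \<forall>x\<in>{-L..L}. Dxn L j (\<lambda>x. f x - g x) x = Dxn L j f x - Dxn L j g x)"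
proof (induction k arbitrary: f g)
  case 0
  then show ?case by (auto simp: C_space_def intro!: continuous_intros)
next
  case (Suc k)
  let ?h = "\<lambda>x. f x - g x"
  note fg = Suc.prems[THEN C_space_Suc(1)]
  have d: "(?h has_real_derivative Dx L f x - Dx L g x) (at x within {-L..L})" if "x \<in> {-L..L}" for x
    using Suc.prems[THEN C_space_Suc(3)] that by (auto intro!: DERIV_diff)
  have "?h \<in> C_space L (Suc k)"
    using Suc.IH[OF fg] by (intro C_space_SucI[OF L d]) auto
  moreover have "Dxn L j ?h x = Dxn L j f x - Dxn L j g x" if "j \<le> Suc k" "x \<in> {-L..L}" for j x
  proof (cases j)
    case (Suc i)
    have "Dxn L j ?h x = Dxn L i (\<lambda>x. Dx L f x - Dx L g x) x"
      unfolding Suc Dxn_Suc' by (rule Dxn_cong) (use that d L Dx_eqI in auto)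
    then show ?thesis using Suc.IH[OF fg] that by (simp add: Suc Dxn_Suc')
  qed simp
  ultimately show ?case by blast
qed

section \<open>The \<open>C^s\<close> norm and continuity in time\<close>

lemma Dxn_le_C_norm:
  assumes L: "L > 0" and f: "f \<in> C_space L k" and j: "j \<le> k" and x: "x \<in> {-L..L}"
  shows "\<bar>Dxn L j f x\<bar> \<le> C_norm L k f"
proof -
  \<comment> \<open>The degenerate time interval \<open>[0, 0]\<close> reduces a claim about a
    single function to the calculus of \<open>jointly_C\<close>. Boundedness from compactness is
    what makes the real-valued suprema in \<open>C_norm\<close> meaningful.\<close>
  have "jointly_C 0 L (k - j) (\<lambda>t. Dxn L j f)"
    using jointly_C_imp[OF L jointly_C_of_C_space[OF f, of 0]] j by auto
  then have "continuous_on {-L..L} (Dxn L j f)"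
    using continuous_on_slice2[OF jointly_C_continuous, of 0 L _ "\<lambda>t. Dxn L j f" 0] by auto
  from continuous_on_compact_bound[OF this compact_Icc] obtain B
    where "\<And>y. y \<in> {-L..L} \<Longrightarrow> \<bar>Dxn L j f y\<bar> \<le> B" by auto
  then have "\<bar>Dxn L j f x\<bar> \<le> (SUP x\<in>{-L..L}. \<bar>Dxn L j f x\<bar>)"
    using x by (intro cSUP_upper bdd_aboveI2) auto
  also have "\<dots> \<le> C_norm L k f"
    unfolding C_norm_def using j by (intro cSUP_upper) auto
  finally show ?thesis .
qed

lemma C_norm_le:
  assumes "L > 0" "\<And>j x. j \<le> k \<Longrightarrow> x \<in> {-L..L} \<Longrightarrow> \<bar>Dxn L j f x\<bar> \<le> B"
  shows "C_norm L k f \<le> B"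
  unfolding C_norm_def using assms by (intro cSUP_least) auto

lemma C_norm_nonneg:
  assumes "L > 0" "f \<in> C_space L k"
  shows "C_norm L k f \<ge> 0"
  using Dxn_le_C_norm[OF assms, of 0 0] assms by auto

text \<open>Each derivative of order at most \<open>k\<close> is uniformly continuous on the compact
  rectangle, so its variation in time is small uniformly in \<open>x\<close>.\<close>

lemma jointly_C_imp_C_time:
  assumes L: "L > 0" and f: "jointly_C T L k f" and X: "\<And>t. t \<in> {0..T} \<Longrightarrow> f t \<in> X"
  shows "f \<in> C_time T X (C_norm L k)"
proof -
  note fk = jointly_C_imp[OF L f]
  have unif: "\<exists>\<delta>>0. \<forall>s\<in>{0..T}. \<forall>t\<in>{0..T}. \<forall>x\<in>{-L..L}. dist s t < \<delta> \<longrightarrow>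
      \<bar>Dxn L j (f s) x - Dxn L j (f t) x\<bar> < e" if "j \<le> k" "e > 0" for j e
  proof -
    have "uniformly_continuous_on ({0..T} \<times> {-L..L}) (\<lambda>(t, x). Dxn L j (f t) x)"
      using fk that
      by (intro compact_uniformly_continuous compact_Times compact_Icc) (auto dest: jointly_C_continuous)
    then obtain \<delta> where "\<delta> > 0" and \<delta>: "\<And>p q. p \<in> {0..T} \<times> {-L..L} \<Longrightarrow> q \<in> {0..T} \<times> {-L..L} \<Longrightarrow>
        dist q p < \<delta> \<Longrightarrow> dist (case q of (t, x) \<Rightarrow> Dxn L j (f t) x) (case p of (t, x) \<Rightarrow> Dxn L j (f t) x) < e"
      using \<open>e > 0\<close> unfolding uniformly_continuous_on_def by metis
    show ?thesis
    proof (intro exI conjI ballI impI)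
      fix s t x assume "s \<in> {0..T}" "t \<in> {0..T}" "x \<in> {-L..L}" "dist s t < \<delta>"
      then show "\<bar>Dxn L j (f s) x - Dxn L j (f t) x\<bar> < e"
        using \<delta>[of "(t, x)" "(s, x)"] by (simp add: dist_Pair_Pair dist_real_def)
    qed fact
  qed
  have "((\<lambda>s. C_norm L k (\<lambda>x. f s x - f t x)) \<longlongrightarrow> 0) (at t within {0..T})" if t: "t \<in> {0..T}" for t
    unfolding tendsto_iff
  proof safe
    fix e :: real assume e: "e > 0"
    \<comment> \<open>One modulus per order \<open>j\<close>, the least of which is
      \<open>m\<close>. The value \<open>e / 2\<close> is used because a strict bound passes through
      the suprema only as a weak one.\<close>
    define \<delta> where "\<delta> j = (SOME \<delta>. \<delta> > 0 \<and> (\<forall>s\<in>{0..T}. \<forall>t\<in>{0..T}. \<forall>x\<in>{-L..L}. dist s t < \<delta> \<longrightarrow>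
      \<bar>Dxn L j (f s) x - Dxn L j (f t) x\<bar> < e / 2))" for j
    have \<delta>: "\<delta> j > 0 \<and> (\<forall>s\<in>{0..T}. \<forall>t\<in>{0..T}. \<forall>x\<in>{-L..L}. dist s t < \<delta> j \<longrightarrow>
      \<bar>Dxn L j (f s) x - Dxn L j (f t) x\<bar> < e / 2)" if "j \<le> k" for j
      unfolding \<delta>_def by (rule someI_ex) (use unif[OF that, of "e / 2"] e in auto)
    define m where "m = Min (\<delta> ` {..k})"
    have m: "m > 0" "\<And>j. j \<le> k \<Longrightarrow> m \<le> \<delta> j"
      using \<delta> by (auto simp: m_def)
    have "dist (C_norm L k (\<lambda>x. f s x - f t x)) 0 < e" if s: "s \<in> {0..T}" "dist s t < m" for s
    proof -
      have c: "f s \<in> C_space L k" "f t \<in> C_space L k" using fk s t by auto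
      note d = C_space_diff[OF L c]
      have "C_norm L k (\<lambda>x. f s x - f t x) \<le> e / 2"
      proof (rule C_norm_le[OF L])
        fix j x assume j: "j \<le> k" and x: "x \<in> {-L..L}"
        have "dist s t < \<delta> j" using s m(2)[OF j] by auto
        then show "\<bar>Dxn L j (\<lambda>x. f s x - f t x) x\<bar> \<le> e / 2"
          using d \<delta>[OF j] j x s t by (auto intro!: less_imp_le)
      qed
      then show ?thesis using C_norm_nonneg[OF L conjunct1[OF d]] e by (simp add: dist_real_def)
    qed
    then show "\<forall>\<^sub>F s in at t within {0..T}. dist (C_norm L k (\<lambda>x. f s x - f t x)) 0 < e"
      using m(1) unfolding eventually_at by blast
  qed
  then show ?thesis using X by (auto simp: C_time_def)
qed

text \<open>The value at \<open>(s, y)\<close> is compared with that at \<open>(t, y)\<close>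
  through the norm of \<open>f s - f t\<close>, then with that at \<open>(t, x)\<close> through
  continuity of the fixed function \<open>Dxn L j (f t)\<close>.\<close>

lemma C_time_continuous_Dxn:
  assumes L: "L > 0" and f: "f \<in> C_time T X (C_norm L k)" and X: "X \<subseteq> C_space L k" and j: "j \<le> k"
  shows "continuous_on ({0..T} \<times> {-L..L}) (\<lambda>(t, x). Dxn L j (f t) x)"
  unfolding continuous_on_def
proof safe
  fix t x assume t: "t \<in> {0..T}" and x: "x \<in> {-L..L}"
  let ?F = "at (t, x) within {0..T} \<times> {-L..L}"
  have sp: "f s \<in> C_space L k" if "s \<in> {0..T}" for s using f X that by (auto simp: C_time_def)
  have "continuous_on {-L..L} (Dxn L j (f t))"
    using jointly_C_imp[OF L jointly_C_of_C_space[OF sp[OF t], of 0]] j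
      continuous_on_slice2[OF jointly_C_continuous, of 0 L _ "\<lambda>_. Dxn L j (f t)" 0] by auto
  then have "continuous_on ({0..T} \<times> {-L..L}) (\<lambda>p. Dxn L j (f t) (snd p))"
    by (rule continuous_on_compose2) (auto intro: continuous_intros)
  then have 1: "((\<lambda>p. Dxn L j (f t) (snd p)) \<longlongrightarrow> Dxn L j (f t) x) ?F"
    using t x by (auto simp: continuous_on_def)
  define n where "n s = C_norm L k (\<lambda>x. f s x - f t x)" for s
  \<comment> \<open>The limit in \<open>C_time\<close> leaves out \<open>s = t\<close>, but points
    near \<open>(t, x)\<close> may have exactly the time \<open>t\<close>. Knowing
    \<open>n t = 0\<close> turns the limit into continuity, which composes with
    \<open>fst\<close>.\<close>
  have n0: "n t = 0"
  proof -
    have "n t \<le> 0" unfolding n_def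
      by (rule C_norm_le[OF L]) (use C_space_diff[OF L sp[OF t] sp[OF t]] in auto)
    moreover have "n t \<ge> 0"
      unfolding n_def using C_norm_nonneg[OF L] C_space_diff[OF L sp[OF t] sp[OF t]] by auto
    ultimately show ?thesis by simp
  qed
  have "(n \<longlongrightarrow> 0) (at t within {0..T})"
    using f t unfolding C_time_def n_def by blast
  then have "continuous (at t within {0..T}) n"
    by (simp add: continuous_within n0)
  moreover have "continuous ?F fst" "fst ` ({0..T} \<times> {-L..L}) \<subseteq> {0..T}"
    by (auto intro: continuous_intros)
  ultimately have "continuous ?F (n \<circ> fst)"
    by (intro continuous_within_compose) (auto intro: continuous_within_subset)
  then have 2: "((\<lambda>p. n (fst p)) \<longlongrightarrow> 0) ?F"
    by (simp add: continuous_within n0 o_def)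
  have "\<forall>\<^sub>F p in ?F. norm (Dxn L j (f (fst p)) (snd p) - Dxn L j (f t) (snd p)) \<le> n (fst p)"
    unfolding eventually_at_filter
  proof (intro always_eventually allI impI)
    fix p assume "p \<in> {0..T} \<times> {-L..L}"
    then have p: "fst p \<in> {0..T}" "snd p \<in> {-L..L}" by auto
    show "norm (Dxn L j (f (fst p)) (snd p) - Dxn L j (f t) (snd p)) \<le> n (fst p)"
      using C_space_diff[OF L sp[OF p(1)] sp[OF t]] j p(2)
        Dxn_le_C_norm[OF L _ j p(2), of "\<lambda>x. f (fst p) x - f t x"] by (auto simp: n_def)
  qed
  then have "((\<lambda>p. Dxn L j (f (fst p)) (snd p) - Dxn L j (f t) (snd p)) \<longlongrightarrow> 0) ?F"
    by (rule Lim_null_comparison[OF _ 2])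
  from tendsto_add[OF this 1]
  show "((\<lambda>(t, x). Dxn L j (f t) x) \<longlongrightarrow> Dxn L j (f t) x) ?F"
    by (simp add: split_def)
qed

subsection \<open>Two-sided Volterra operators and variation of constants\<close>

text \<open>The weights outside the integrals are separate from \<open>p\<close> and
  \<open>q\<close> inside: differentiating in \<open>x\<close> changes only the outer ones and adds
  a local term, so derivatives of Green operators stay in the family.\<close>

definition green_op ::
  "real \<Rightarrow> real \<Rightarrow> (real \<Rightarrow> real) \<Rightarrow> (real \<Rightarrow> real) \<Rightarrow> (real \<Rightarrow> real) \<Rightarrow> (real \<Rightarrow> real) \<Rightarrow>
   (real \<Rightarrow> real) \<Rightarrow> real \<Rightarrow> real" where
  "green_op L c w1 w2 p q f x =
     c * (w2 x * integral {-L..x} (\<lambda>\<xi>. p \<xi> * f \<xi>) + w1 x * integral {x..L} (\<lambda>\<xi>. q \<xi> * f \<xi>))"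

text \<open>On each side of \<open>\<xi> = x\<close> the kernel is a product of differentiable
  factors, and the diagonal point is negligible for the integral.\<close>

lemma integral_deriv_green_kernel:
  assumes w: "\<And>x. (w1 has_real_derivative p x) (at x)" "\<And>x. (w2 has_real_derivative q x) (at x)"
    and c: "continuous_on {-L..L} p" "continuous_on {-L..L} q" "continuous_on {-L..L} f"
    and x: "x \<in> {-L..L}"
  shows "integral {-L..L} (\<lambda>\<xi>. deriv (\<lambda>z. green_kernel c W w1 w2 x z) \<xi> * f \<xi>) =
    green_op L (- (1 / (c * W))) w1 w2 p q f x"
proof (rule integral_unique)
  define k where "k = - (1 / (c * W))"
  let ?D = "\<lambda>\<xi>. deriv (\<lambda>z. green_kernel c W w1 w2 x z) \<xi>"
  have D1: "?D \<xi> = k * w2 x * p \<xi>" if "\<xi> < x" for \<xi>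
  proof (rule DERIV_imp_deriv, rule has_field_derivative_transform_within_open[of _ _ _ "{..<x}"])
    show "((\<lambda>z. k * (w1 z * w2 x)) has_real_derivative k * w2 x * p \<xi>) (at \<xi>)"
      by (auto intro!: derivative_eq_intros w)
  qed (use that in \<open>auto simp: green_kernel_def k_def\<close>)
  have D2: "?D \<xi> = k * w1 x * q \<xi>" if "\<xi> > x" for \<xi>
  proof (rule DERIV_imp_deriv, rule has_field_derivative_transform_within_open[of _ _ _ "{x<..}"])
    show "((\<lambda>z. k * (w1 x * w2 z)) has_real_derivative k * w1 x * q \<xi>) (at \<xi>)"
      by (auto intro!: derivative_eq_intros w)
  qed (use that in \<open>auto simp: green_kernel_def k_def\<close>)
  have "((\<lambda>\<xi>. p \<xi> * f \<xi>) has_integral integral {-L..x} (\<lambda>\<xi>. p \<xi> * f \<xi>)) {-L..x}"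
    using x c by (intro integrable_integral integrable_continuous_real continuous_intros)
      (auto intro: continuous_on_subset)
  from has_integral_mult_right[OF this, of "k * w2 x"]
  have 1: "((\<lambda>\<xi>. ?D \<xi> * f \<xi>) has_integral k * w2 x * integral {-L..x} (\<lambda>\<xi>. p \<xi> * f \<xi>)) {-L..x}"
    by (rule has_integral_spike_finite[of "{x}", rotated 2]) (auto simp: D1)
  have "((\<lambda>\<xi>. q \<xi> * f \<xi>) has_integral integral {x..L} (\<lambda>\<xi>. q \<xi> * f \<xi>)) {x..L}"
    using x c by (intro integrable_integral integrable_continuous_real continuous_intros)
      (auto intro: continuous_on_subset)
  from has_integral_mult_right[OF this, of "k * w1 x"]
  have 2: "((\<lambda>\<xi>. ?D \<xi> * f \<xi>) has_integral k * w1 x * integral {x..L} (\<lambda>\<xi>. q \<xi> * f \<xi>)) {x..L}"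
    by (rule has_integral_spike_finite[of "{x}", rotated 2]) (auto simp: D2)
  show "((\<lambda>\<xi>. ?D \<xi> * f \<xi>) has_integral green_op L (- (1 / (c * W))) w1 w2 p q f x) {-L..L}"
    using has_integral_combine[OF _ _ 1 2] x by (simp add: green_op_def k_def distrib_left mult.assoc)
qed

text \<open>At an end point one of the two integrals runs over a single point, so one vanishing
  weight annihilates the operator for every \<open>f\<close>.\<close>

lemma green_op_boundary:
  "w2 L = 0 \<Longrightarrow> green_op L c w1 w2 p q f L = 0"
  "w1 (-L) = 0 \<Longrightarrow> green_op L c w1 w2 p q f (-L) = 0"
  by (simp_all add: green_op_def)

lemma green_op_jointly_C:
  assumes "jointly_C T L (Suc k) (\<lambda>t. w1)" "jointly_C T L (Suc k) (\<lambda>t. w2)"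
    "jointly_C T L k (\<lambda>t. p)" "jointly_C T L k (\<lambda>t. q)" "jointly_C T L k f"
  shows "jointly_C T L (Suc k) (\<lambda>t x. green_op L c w1 w2 p q (f t) x)"
  unfolding green_op_def
  by (intro jointly_C_cmult jointly_C_add jointly_C_mult[of _ _ "Suc k"] assms jointly_C_antiderivative
      jointly_C_antiderivative' jointly_C_mult[of _ _ k])

text \<open>The local term comes from differentiating the limits of integration. For
  \<open>p\<close> and \<open>q\<close> the derivatives of \<open>w1\<close> and \<open>w2\<close>
  its factor is a Wronskian; for \<open>w1 = p\<close> and \<open>w2 = q\<close> it cancels.\<close>

lemma DERIV_green_op:
  assumes c: "continuous_on {-L..L} p" "continuous_on {-L..L} q" "continuous_on {-L..L} f"
    and w: "\<And>x. (w1 has_real_derivative w1' x) (at x within {-L..L})"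
      "\<And>x. (w2 has_real_derivative w2' x) (at x within {-L..L})"
    and x: "x \<in> {-L..L}"
  shows "(green_op L c w1 w2 p q f has_real_derivative
    green_op L c w1' w2' p q f x + c * (w2 x * p x - w1 x * q x) * f x) (at x within {-L..L})"
proof -
  note [derivative_intros] = integral_has_real_derivative[OF continuous_on_mult[OF c(1,3)] x]
    integral_has_real_derivative'[OF continuous_on_mult[OF c(2,3)] x]
  show ?thesis unfolding green_op_def[abs_def]
    by (rule derivative_eq_intros w refl)+ (simp add: algebra_simps)
qed

lemma green_op_diff:
  assumes c: "continuous_on {-L..L} p" "continuous_on {-L..L} q"
    "continuous_on {-L..L} f" "continuous_on {-L..L} g"
    and x: "x \<in> {-L..L}"
  shows "green_op L c w1 w2 p q (\<lambda>\<xi>. f \<xi> - g \<xi>) x = green_op L c w1 w2 p q f x - green_op L c w1 w2 p q g x"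
proof -
  have i: "(\<lambda>\<xi>. r \<xi> * h \<xi>) integrable_on {-L..x}" "(\<lambda>\<xi>. r \<xi> * h \<xi>) integrable_on {x..L}"
    if "continuous_on {-L..L} r" "continuous_on {-L..L} h" for r h :: "real \<Rightarrow> real"
    by (rule integrable_continuous_real, rule continuous_on_subset[OF continuous_on_mult[OF that]],
        use x in auto)+
  show ?thesis
    using i[OF c(1) c(3)] i[OF c(1) c(4)] i[OF c(2) c(3)] i[OF c(2) c(4)]
    by (simp add: green_op_def right_diff_distrib integral_diff algebra_simps)
qed

lemma green_op_bound:
  assumes c: "continuous_on {-L..L} w1" "continuous_on {-L..L} w2"
    "continuous_on {-L..L} p" "continuous_on {-L..L} q"
  obtains K where "K \<ge> 0" "\<And>f \<delta> x. continuous_on {-L..L} f \<Longrightarrow> (\<And>x. x \<in> {-L..L} \<Longrightarrow> \<bar>f x\<bar> \<le> \<delta>) \<Longrightarrow>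
     x \<in> {-L..L} \<Longrightarrow> \<bar>green_op L c w1 w2 p q f x\<bar> \<le> K * \<delta>"
proof -
  obtain B1 where B1: "B1 \<ge> 0" "\<And>x. x \<in> {-L..L} \<Longrightarrow> \<bar>w1 x\<bar> \<le> B1"
    using continuous_on_compact_bound[OF c(1) compact_Icc] by auto
  obtain B2 where B2: "B2 \<ge> 0" "\<And>x. x \<in> {-L..L} \<Longrightarrow> \<bar>w2 x\<bar> \<le> B2"
    using continuous_on_compact_bound[OF c(2) compact_Icc] by auto
  obtain P where P: "P \<ge> 0" "\<And>x. x \<in> {-L..L} \<Longrightarrow> \<bar>p x\<bar> \<le> P"
    using continuous_on_compact_bound[OF c(3) compact_Icc] by auto
  obtain Q where Q: "Q \<ge> 0" "\<And>x. x \<in> {-L..L} \<Longrightarrow> \<bar>q x\<bar> \<le> Q"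
    using continuous_on_compact_bound[OF c(4) compact_Icc] by auto
  \<comment> \<open>The sup bounds of the weights times the length of the interval, entering in
    absolute value because the sign of \<open>L\<close> is left open here.\<close>
  define K where "K = \<bar>c\<bar> * (B2 * (P * \<bar>2 * L\<bar>) + B1 * (Q * \<bar>2 * L\<bar>))"
  show ?thesis
  proof (rule that[of K])
    show "K \<ge> 0" unfolding K_def using B1 B2 P Q by (intro mult_nonneg_nonneg add_nonneg_nonneg) auto
    fix f :: "real \<Rightarrow> real" and \<delta> x :: real
    assume f: "continuous_on {-L..L} f" "\<And>x. x \<in> {-L..L} \<Longrightarrow> \<bar>f x\<bar> \<le> \<delta>" and x: "x \<in> {-L..L}"
    have \<delta>: "\<delta> \<ge> 0" using f(2)[OF x] by linarith
    have int: "\<bar>integral {l..h} (\<lambda>\<xi>. r \<xi> * f \<xi>)\<bar> \<le> R * \<bar>2 * L\<bar> * \<delta>"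
      if r: "continuous_on {-L..L} r" "(R::real) \<ge> 0" "\<And>x. x \<in> {-L..L} \<Longrightarrow> \<bar>r x\<bar> \<le> R"
        and lh: "-L \<le> l" "l \<le> h" "h \<le> L" for r R l h
    proof -
      have "norm (integral {l..h} (\<lambda>\<xi>. r \<xi> * f \<xi>)) \<le> (R * \<delta>) * (h - l)"
      proof (rule integral_bound[OF lh(2)])
        show "continuous_on {l..h} (\<lambda>\<xi>. r \<xi> * f \<xi>)"
          using lh by (intro continuous_on_subset[OF continuous_on_mult[OF r(1) f(1)]]) auto
        show "norm (r t * f t) \<le> R * \<delta>" if "t \<in> {l..h}" for t
          using r f lh that by (auto simp: abs_mult intro!: mult_mono)
      qed
      also have "\<dots> \<le> (R * \<delta>) * \<bar>2 * L\<bar>"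
        using lh r(2) \<delta> by (intro mult_left_mono) auto
      finally show ?thesis by (simp add: ac_simps)
    qed
    have "\<bar>green_op L c w1 w2 p q f x\<bar> \<le> \<bar>c\<bar> *
        (\<bar>w2 x\<bar> * \<bar>integral {-L..x} (\<lambda>\<xi>. p \<xi> * f \<xi>)\<bar> + \<bar>w1 x\<bar> * \<bar>integral {x..L} (\<lambda>\<xi>. q \<xi> * f \<xi>)\<bar>)"
      unfolding green_op_def abs_mult[of c]
      by (intro mult_left_mono order_trans[OF abs_triangle_ineq]) (auto simp: abs_mult)
    also have "\<dots> \<le> \<bar>c\<bar> * (B2 * (P * \<bar>2 * L\<bar> * \<delta>) + B1 * (Q * \<bar>2 * L\<bar> * \<delta>))"
      using x by (intro mult_left_mono add_mono mult_mono B1 B2 int c P Q) auto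
    also have "\<dots> = K * \<delta>" by (simp add: K_def algebra_simps)
    finally show "\<bar>green_op L c w1 w2 p q f x\<bar> \<le> K * \<delta>" .
  qed
qed

text \<open>The homogeneous system \<open>y' = - \<alpha> z\<close>, \<open>z' = \<beta> y\<close>
  is a rotation of frequency \<open>\<mu>\<close> after rescaling. \<open>P\<close> and
  \<open>Q\<close> are \<open>(y, z)\<close> rotated back to time 0, so their time derivatives
  involve only \<open>g1\<close> and \<open>g2\<close>; rotating forward again gives the
  formulas.\<close>

lemma variation_of_constants:
  fixes y z g1 g2 :: "real \<Rightarrow> real"
  assumes pos: "\<alpha> > 0" "\<beta> > 0" and \<mu>: "\<mu> = sqrt (\<alpha> * \<beta>)"
    and c: "continuous_on {0..T} y" "continuous_on {0..T} z"
      "continuous_on {0..T} g1" "continuous_on {0..T} g2"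
    and y: "\<And>t. t \<in> {0..T} \<Longrightarrow> y t = y0 + integral {0..t} (\<lambda>s. g1 s - \<alpha> * z s)"
    and z: "\<And>t. t \<in> {0..T} \<Longrightarrow> z t = z0 + integral {0..t} (\<lambda>s. g2 s + \<beta> * y s)"
    and t: "t \<in> {0..T}"
  defines "P \<equiv> \<lambda>t. y0 + integral {0..t} (\<lambda>s. cos (\<mu> * s) * g1 s + \<alpha> / \<mu> * (sin (\<mu> * s) * g2 s))"
    and "Q \<equiv> \<lambda>t. z0 + integral {0..t} (\<lambda>s. cos (\<mu> * s) * g2 s - \<beta> / \<mu> * (sin (\<mu> * s) * g1 s))"
  shows "y t = cos (\<mu> * t) * P t - \<alpha> / \<mu> * (sin (\<mu> * t) * Q t)"
    and "z t = cos (\<mu> * t) * Q t + \<beta> / \<mu> * (sin (\<mu> * t) * P t)"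
proof -
  have \<mu>0: "\<mu> > 0" and \<mu>2: "\<mu> * \<mu> = \<alpha> * \<beta>" using pos by (auto simp: \<mu>)
  have ab: "\<alpha> / \<mu> * \<beta> = \<mu>" "\<beta> / \<mu> * \<alpha> = \<mu>" "\<alpha> / \<mu> * (\<beta> / \<mu>) = 1"
    using \<mu>0 \<mu>2 pos by (auto simp: field_simps)
  have dy: "(y has_real_derivative g1 s - \<alpha> * z s) (at s within {0..T})" if s: "s \<in> {0..T}" for s
  proof (subst has_real_derivative_within_cong[OF y s])
    show "((\<lambda>t. y0 + integral {0..t} (\<lambda>s. g1 s - \<alpha> * z s)) has_real_derivative g1 s - \<alpha> * z s) (at s within {0..T})"
    proof -
      have "continuous_on {0..T} (\<lambda>s. g1 s - \<alpha> * z s)" by (intro continuous_intros c)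
      from integral_has_real_derivative[OF this s] show ?thesis
        by (auto intro!: derivative_eq_intros)
    qed
  qed auto
  have dz: "(z has_real_derivative g2 s + \<beta> * y s) (at s within {0..T})" if s: "s \<in> {0..T}" for s
  proof (subst has_real_derivative_within_cong[OF z s])
    show "((\<lambda>t. z0 + integral {0..t} (\<lambda>s. g2 s + \<beta> * y s)) has_real_derivative g2 s + \<beta> * y s) (at s within {0..T})"
    proof -
      have "continuous_on {0..T} (\<lambda>s. g2 s + \<beta> * y s)" by (intro continuous_intros c)
      from integral_has_real_derivative[OF this s] show ?thesis
        by (auto intro!: derivative_eq_intros)
    qed
  qed auto
  have sub: "(f has_vector_derivative D) (at s within {0..t})"
    if "(f has_real_derivative D) (at s within {0..T})" for f D s
    using that t unfolding has_real_derivative_iff_has_vector_derivative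
    by (rule_tac has_vector_derivative_within_subset) auto
  have 0: "y 0 = y0" "z 0 = z0" using y[of 0] z[of 0] t by auto
  have "((\<lambda>s. cos (\<mu> * s) * g1 s + \<alpha> / \<mu> * (sin (\<mu> * s) * g2 s)) has_integral
      (cos (\<mu> * t) * y t + \<alpha> / \<mu> * (sin (\<mu> * t) * z t)) -
      (cos (\<mu> * 0) * y 0 + \<alpha> / \<mu> * (sin (\<mu> * 0) * z 0))) {0..t}"
  proof (rule fundamental_theorem_of_calculus)
    fix s assume "s \<in> {0..t}"
    with t have s: "s \<in> {0..T}" by auto
    show "((\<lambda>t. cos (\<mu> * t) * y t + \<alpha> / \<mu> * (sin (\<mu> * t) * z t)) has_vector_derivative
      cos (\<mu> * s) * g1 s + \<alpha> / \<mu> * (sin (\<mu> * s) * g2 s)) (at s within {0..t})"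
    proof (rule sub, rule DERIV_cong)
      \<comment> \<open>The terms in \<open>z\<close> cancel outright; those in \<open>y\<close> are
        collected with the factor \<open>\<alpha> / \<mu> * \<beta> - \<mu>\<close>, which is zero
        since \<open>\<mu> * \<mu> = \<alpha> * \<beta>\<close>.\<close>
      have "cos (\<mu> * s) * (g1 s - \<alpha> * z s) - sin (\<mu> * s) * \<mu> * y s
          + (\<alpha> / \<mu>) * (sin (\<mu> * s) * (g2 s + \<beta> * y s) + cos (\<mu> * s) * \<mu> * z s) =
        cos (\<mu> * s) * g1 s + \<alpha> / \<mu> * (sin (\<mu> * s) * g2 s)
          + (\<alpha> / \<mu> * \<beta> - \<mu>) * (sin (\<mu> * s) * y s)"
        using \<mu>0 by (simp add: field_simps)
      then show "cos (\<mu> * s) * (g1 s - \<alpha> * z s) - sin (\<mu> * s) * \<mu> * y s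
          + (\<alpha> / \<mu>) * (sin (\<mu> * s) * (g2 s + \<beta> * y s) + cos (\<mu> * s) * \<mu> * z s) =
        cos (\<mu> * s) * g1 s + \<alpha> / \<mu> * (sin (\<mu> * s) * g2 s)"
        by (simp only: ab diff_self mult_zero_left add_0_right)
    qed (rule derivative_eq_intros dy[OF s] dz[OF s] refl | simp)+
  qed (use t in auto)
  then have P: "P t = cos (\<mu> * t) * y t + \<alpha> / \<mu> * (sin (\<mu> * t) * z t)"
    by (simp add: P_def 0 integral_unique)
  have "((\<lambda>s. cos (\<mu> * s) * g2 s - \<beta> / \<mu> * (sin (\<mu> * s) * g1 s)) has_integral
      (cos (\<mu> * t) * z t - \<beta> / \<mu> * (sin (\<mu> * t) * y t)) -
      (cos (\<mu> * 0) * z 0 - \<beta> / \<mu> * (sin (\<mu> * 0) * y 0))) {0..t}"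
  proof (rule fundamental_theorem_of_calculus)
    fix s assume "s \<in> {0..t}"
    with t have s: "s \<in> {0..T}" by auto
    show "((\<lambda>t. cos (\<mu> * t) * z t - \<beta> / \<mu> * (sin (\<mu> * t) * y t)) has_vector_derivative
      cos (\<mu> * s) * g2 s - \<beta> / \<mu> * (sin (\<mu> * s) * g1 s)) (at s within {0..t})"
    proof (rule sub, rule DERIV_cong)
      have "cos (\<mu> * s) * (g2 s + \<beta> * y s) - sin (\<mu> * s) * \<mu> * z s
          - (\<beta> / \<mu>) * (sin (\<mu> * s) * (g1 s - \<alpha> * z s) + cos (\<mu> * s) * \<mu> * y s) =
        cos (\<mu> * s) * g2 s - \<beta> / \<mu> * (sin (\<mu> * s) * g1 s)
          + (\<beta> / \<mu> * \<alpha> - \<mu>) * (sin (\<mu> * s) * z s)"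
        using \<mu>0 by (simp add: field_simps)
      then show "cos (\<mu> * s) * (g2 s + \<beta> * y s) - sin (\<mu> * s) * \<mu> * z s
          - (\<beta> / \<mu>) * (sin (\<mu> * s) * (g1 s - \<alpha> * z s) + cos (\<mu> * s) * \<mu> * y s) =
        cos (\<mu> * s) * g2 s - \<beta> / \<mu> * (sin (\<mu> * s) * g1 s)"
        by (simp only: ab diff_self mult_zero_left add_0_right)
    qed (rule derivative_eq_intros dy[OF s] dz[OF s] refl | simp)+
  qed (use t in auto)
  then have Q: "Q t = cos (\<mu> * t) * z t - \<beta> / \<mu> * (sin (\<mu> * t) * y t)"
    by (simp add: Q_def 0 integral_unique)
  have sc: "cos (\<mu> * t) * cos (\<mu> * t) + sin (\<mu> * t) * sin (\<mu> * t) = 1"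
    using sin_cos_squared_add3 by (simp add: add.commute)
  have "cos (\<mu> * t) * P t - \<alpha> / \<mu> * (sin (\<mu> * t) * Q t) =
      cos (\<mu> * t) * cos (\<mu> * t) * y t + (\<alpha> / \<mu> * (\<beta> / \<mu>)) * (sin (\<mu> * t) * sin (\<mu> * t)) * y t"
    unfolding P Q by (simp add: algebra_simps)
  also have "\<dots> = (cos (\<mu> * t) * cos (\<mu> * t) + sin (\<mu> * t) * sin (\<mu> * t)) * y t"
    by (simp only: ab mult_1_left distrib_right)
  finally show "y t = cos (\<mu> * t) * P t - \<alpha> / \<mu> * (sin (\<mu> * t) * Q t)" by (simp add: sc)
  have "cos (\<mu> * t) * Q t + \<beta> / \<mu> * (sin (\<mu> * t) * P t) =
      cos (\<mu> * t) * cos (\<mu> * t) * z t + (\<alpha> / \<mu> * (\<beta> / \<mu>)) * (sin (\<mu> * t) * sin (\<mu> * t)) * z t"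
    unfolding P Q by (simp add: algebra_simps)
  also have "\<dots> = (cos (\<mu> * t) * cos (\<mu> * t) + sin (\<mu> * t) * sin (\<mu> * t)) * z t"
    by (simp only: ab mult_1_left distrib_right)
  finally show "z t = cos (\<mu> * t) * Q t + \<beta> / \<mu> * (sin (\<mu> * t) * P t)" by (simp add: sc)
qed

text \<open>From mere continuity, \<open>y\<close> and \<open>z\<close> rise to the regularity of
  the data and of \<open>g1\<close>, \<open>g2\<close>, because after solving the system they no
  longer occur on the right-hand side.\<close>

lemma jointly_C_variation_of_constants:
  assumes pos: "\<alpha> > 0" "\<beta> > 0"
    and c: "jointly_C T L 0 y" "jointly_C T L 0 z" "jointly_C T L k g1" "jointly_C T L k g2"
      "jointly_C T L k (\<lambda>t. y0)" "jointly_C T L k (\<lambda>t. z0)"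
    and y: "\<And>t x. t \<in> {0..T} \<Longrightarrow> x \<in> {-L..L} \<Longrightarrow>
      y t x = y0 x + integral {0..t} (\<lambda>s. g1 s x - \<alpha> * z s x)"
    and z: "\<And>t x. t \<in> {0..T} \<Longrightarrow> x \<in> {-L..L} \<Longrightarrow>
      z t x = z0 x + integral {0..t} (\<lambda>s. g2 s x + \<beta> * y s x)"
  shows "jointly_C T L k y" "jointly_C T L k z"
proof -
  define \<mu> where "\<mu> = sqrt (\<alpha> * \<beta>)"
  let ?P = "\<lambda>t x. y0 x + integral {0..t} (\<lambda>s. cos (\<mu> * s) * g1 s x + \<alpha> / \<mu> * (sin (\<mu> * s) * g2 s x))"
  let ?Q = "\<lambda>t x. z0 x + integral {0..t} (\<lambda>s. cos (\<mu> * s) * g2 s x - \<beta> / \<mu> * (sin (\<mu> * s) * g1 s x))"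
  have cs: "jointly_C T L k (\<lambda>t x. cos (\<mu> * t))" "jointly_C T L k (\<lambda>t x. sin (\<mu> * t))"
    by (auto intro!: jointly_C_time continuous_intros)
  have PQ: "jointly_C T L k ?P" "jointly_C T L k ?Q"
    by (intro jointly_C_add jointly_C_diff jointly_C_time_integral jointly_C_mult[OF cs(1)]
        jointly_C_mult[OF cs(2)] jointly_C_cmult c)+
  have eq: "y t x = cos (\<mu> * t) * ?P t x - \<alpha> / \<mu> * (sin (\<mu> * t) * ?Q t x)"
    "z t x = cos (\<mu> * t) * ?Q t x + \<beta> / \<mu> * (sin (\<mu> * t) * ?P t x)"
    if t: "t \<in> {0..T}" and x: "x \<in> {-L..L}" for t x
    using variation_of_constants[OF pos \<mu>_def continuous_on_slice1[OF jointly_C_continuous[OF c(1)] x]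
      continuous_on_slice1[OF jointly_C_continuous[OF c(2)] x]
      continuous_on_slice1[OF jointly_C_continuous[OF c(3)] x]
      continuous_on_slice1[OF jointly_C_continuous[OF c(4)] x] y[OF _ x] z[OF _ x] t]
    by blast+
  show "jointly_C T L k y"
    by (subst jointly_C_cong[OF eq(1)])
      (assumption | intro jointly_C_diff jointly_C_mult[OF cs(1)] jointly_C_cmult jointly_C_mult[OF cs(2)] PQ)+
  show "jointly_C T L k z"
    by (subst jointly_C_cong[OF eq(2)])
      (assumption | intro jointly_C_add jointly_C_mult[OF cs(1)] jointly_C_cmult jointly_C_mult[OF cs(2)] PQ)+
qed

subsection \<open>The extended system\<close>

locale boussinesq =
  fixes L a b d :: real
  assumes L: "L > 0" and a: "a < 0" and b: "b > 0" and d: "d > 0"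
begin

definition cN :: real where "cN = - (1 / (b * (- (1 / sqrt b) * sinh (2 * L / sqrt b))))"

definition cD :: real where "cD = - (1 / (d * (- (1 / sqrt d) * sinh (2 * L / sqrt d))))"

definition LN :: "(real \<Rightarrow> real) \<Rightarrow> real \<Rightarrow> real" where
  "LN = green_op L cN (\<lambda>x. cosh ((L + x) / sqrt b)) (\<lambda>x. cosh ((L - x) / sqrt b))
     (\<lambda>x. sinh ((L + x) / sqrt b) / sqrt b) (\<lambda>x. - sinh ((L - x) / sqrt b) / sqrt b)"

text \<open>\<open>LN'\<close> and \<open>LD'\<close> are only the smoothing parts of the derivatives: \<open>\<partial>\<^sub>x LN f = LN' f + f / b\<close> and
  \<open>\<partial>\<^sub>x LD f = LD' f + f / d\<close>, the local terms coming from the kink of the kernel. In contrast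
  \<open>LD''\<close> is the full derivative of \<open>LD'\<close>.\<close>

definition LN' :: "(real \<Rightarrow> real) \<Rightarrow> real \<Rightarrow> real" where
  "LN' = green_op L cN (\<lambda>x. sinh ((L + x) / sqrt b) / sqrt b) (\<lambda>x. - sinh ((L - x) / sqrt b) / sqrt b)
     (\<lambda>x. sinh ((L + x) / sqrt b) / sqrt b) (\<lambda>x. - sinh ((L - x) / sqrt b) / sqrt b)"

definition LD :: "(real \<Rightarrow> real) \<Rightarrow> real \<Rightarrow> real" where
  "LD = green_op L cD (\<lambda>x. sinh ((L + x) / sqrt d)) (\<lambda>x. sinh ((L - x) / sqrt d))
     (\<lambda>x. cosh ((L + x) / sqrt d) / sqrt d) (\<lambda>x. - cosh ((L - x) / sqrt d) / sqrt d)"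

definition LD' :: "(real \<Rightarrow> real) \<Rightarrow> real \<Rightarrow> real" where
  "LD' = green_op L cD (\<lambda>x. cosh ((L + x) / sqrt d) / sqrt d) (\<lambda>x. - cosh ((L - x) / sqrt d) / sqrt d)
     (\<lambda>x. cosh ((L + x) / sqrt d) / sqrt d) (\<lambda>x. - cosh ((L - x) / sqrt d) / sqrt d)"

definition LD'' :: "(real \<Rightarrow> real) \<Rightarrow> real \<Rightarrow> real" where
  "LD'' = green_op L cD (\<lambda>x. sinh ((L + x) / sqrt d) / d) (\<lambda>x. sinh ((L - x) / sqrt d) / d)
     (\<lambda>x. cosh ((L + x) / sqrt d) / sqrt d) (\<lambda>x. - cosh ((L - x) / sqrt d) / sqrt d)"

section \<open>The hyperbolic kernels: regularity, jump and boundary values\<close>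

lemma DERIV_omega:
  assumes "c > 0"
  shows "((\<lambda>x. cosh ((L + x) / sqrt c)) has_real_derivative sinh ((L + x) / sqrt c) / sqrt c) (at x within S)"
    "((\<lambda>x. cosh ((L - x) / sqrt c)) has_real_derivative - sinh ((L - x) / sqrt c) / sqrt c) (at x within S)"
    "((\<lambda>x. sinh ((L + x) / sqrt c)) has_real_derivative cosh ((L + x) / sqrt c) / sqrt c) (at x within S)"
    "((\<lambda>x. sinh ((L - x) / sqrt c)) has_real_derivative - cosh ((L - x) / sqrt c) / sqrt c) (at x within S)"
  using assms by (auto intro!: derivative_eq_intros simp: field_simps)

lemma continuous_omega:
  assumes "c > 0"
  shows "continuous_on S (\<lambda>x. cosh ((L + x) / sqrt c))" "continuous_on S (\<lambda>x. cosh ((L - x) / sqrt c))"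
    "continuous_on S (\<lambda>x. sinh ((L + x) / sqrt c))" "continuous_on S (\<lambda>x. sinh ((L - x) / sqrt c))"
  using assms by (auto intro!: continuous_intros)

lemma continuous_omega':
  "continuous_on S (\<lambda>x. sinh ((L + x) / sqrt b) / sqrt b)"
  "continuous_on S (\<lambda>x. - sinh ((L - x) / sqrt b) / sqrt b)"
  "continuous_on S (\<lambda>x. cosh ((L + x) / sqrt d) / sqrt d)"
  "continuous_on S (\<lambda>x. - cosh ((L - x) / sqrt d) / sqrt d)"
  using b d by (auto intro!: continuous_intros continuous_omega)

lemma jointly_C_omega:
  "jointly_C T L k (\<lambda>t x. cosh ((L + x) / s))" "jointly_C T L k (\<lambda>t x. cosh ((L - x) / s))"
  "jointly_C T L k (\<lambda>t x. sinh ((L + x) / s))" "jointly_C T L k (\<lambda>t x. sinh ((L - x) / s))"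
  using jointly_C_cosh_sinh[of T L k "1 / s" "L / s"] jointly_C_cosh_sinh[of T L k "- 1 / s" "L / s"]
  by (simp_all add: add_divide_distrib diff_divide_distrib add.commute)

lemma jointly_C_omega_div:
  "jointly_C T L k (\<lambda>t x. cosh ((L + x) / s) / r)" "jointly_C T L k (\<lambda>t x. - cosh ((L - x) / s) / r)"
  "jointly_C T L k (\<lambda>t x. sinh ((L + x) / s) / r)" "jointly_C T L k (\<lambda>t x. - sinh ((L - x) / s) / r)"
  "jointly_C T L k (\<lambda>t x. sinh ((L - x) / s) / r)"
  using jointly_C_omega[of T k s, THEN jointly_C_cmult, of "1 / r"]
    jointly_C_omega[of T k s, THEN jointly_C_cmult, of "- 1 / r"]
  by simp_all

lemma L_N_eq_LN:
  assumes "continuous_on {-L..L} f" "x \<in> {-L..L}"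
  shows "L_N L b f x = LN f x"
  unfolding L_N_def F_green_def LN_def cN_def
  by (rule integral_deriv_green_kernel) (rule DERIV_omega[OF b] continuous_omega' assms)+

lemma L_D_eq_LD:
  assumes "continuous_on {-L..L} f" "x \<in> {-L..L}"
  shows "L_D L d f x = LD f x"
  unfolding L_D_def G_green_def LD_def cD_def
  by (rule integral_deriv_green_kernel) (rule DERIV_omega[OF d] continuous_omega' assms)+

lemma jointly_C_LN: "jointly_C T L k f \<Longrightarrow> jointly_C T L (Suc k) (\<lambda>t x. LN (f t) x)"
  unfolding LN_def by (intro green_op_jointly_C jointly_C_omega jointly_C_omega_div)

lemma jointly_C_LN': "jointly_C T L k f \<Longrightarrow> jointly_C T L (Suc k) (\<lambda>t x. LN' (f t) x)"
  unfolding LN'_def by (intro green_op_jointly_C jointly_C_omega_div)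

lemma jointly_C_LD: "jointly_C T L k f \<Longrightarrow> jointly_C T L (Suc k) (\<lambda>t x. LD (f t) x)"
  unfolding LD_def by (intro green_op_jointly_C jointly_C_omega jointly_C_omega_div)

lemma jointly_C_LD': "jointly_C T L k f \<Longrightarrow> jointly_C T L (Suc k) (\<lambda>t x. LD' (f t) x)"
  unfolding LD'_def by (intro green_op_jointly_C jointly_C_omega_div)

lemma jointly_C_LD'': "jointly_C T L k f \<Longrightarrow> jointly_C T L (Suc k) (\<lambda>t x. LD'' (f t) x)"
  unfolding LD''_def by (intro green_op_jointly_C jointly_C_omega_div)

text \<open>The two arguments add up to \<open>2 * L / sqrt c\<close>, so the addition theorem makes
  the sum independent of \<open>x\<close> and the prefactor of the kernel cancels it. A further
  division by \<open>sqrt c\<close> yields the coefficient \<open>1 / c\<close> of the local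
  terms.\<close>

lemma wronskian:
  assumes "c > 0"
  shows "- (1 / (c * (- (1 / sqrt c) * sinh (2 * L / sqrt c)))) *
    (sinh ((L + x) / sqrt c) * cosh ((L - x) / sqrt c) +
     cosh ((L + x) / sqrt c) * sinh ((L - x) / sqrt c)) = sqrt c / c"
proof -
  have "(L + x) / sqrt c + (L - x) / sqrt c = 2 * L / sqrt c"
    by (simp add: add_divide_distrib diff_divide_distrib)
  then have "sinh ((L + x) / sqrt c) * cosh ((L - x) / sqrt c) +
     cosh ((L + x) / sqrt c) * sinh ((L - x) / sqrt c) = sinh (2 * L / sqrt c)"
    by (metis sinh_add)
  moreover have "sinh (2 * L / sqrt c) > 0" using L assms by simp
  ultimately show ?thesis using assms by (simp add: field_simps)
qed

lemma DERIV_LN: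
  assumes f: "continuous_on {-L..L} f" and x: "x \<in> {-L..L}"
  shows "(LN f has_real_derivative LN' f x + f x / b) (at x within {-L..L})"
proof -
  have "cN * (cosh ((L - x) / sqrt b) * (sinh ((L + x) / sqrt b) / sqrt b) -
      cosh ((L + x) / sqrt b) * (- sinh ((L - x) / sqrt b) / sqrt b)) = 1 / b"
    using wronskian[OF b, of x] b unfolding cN_def[symmetric] by (simp add: field_simps)
  with DERIV_green_op[OF continuous_omega'(1,2) f DERIV_omega(1,2)[OF b] x, of cN] show ?thesis
    by (simp add: LN_def LN'_def)
qed

lemma DERIV_LD:
  assumes f: "continuous_on {-L..L} f" and x: "x \<in> {-L..L}"
  shows "(LD f has_real_derivative LD' f x + f x / d) (at x within {-L..L})"
proof -
  have "cD * (sinh ((L - x) / sqrt d) * (cosh ((L + x) / sqrt d) / sqrt d) -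
      sinh ((L + x) / sqrt d) * (- cosh ((L - x) / sqrt d) / sqrt d)) = 1 / d"
    using wronskian[OF d, of x] d unfolding cD_def[symmetric] by (simp add: field_simps)
  with DERIV_green_op[OF continuous_omega'(3,4) f DERIV_omega(3,4)[OF d] x, of cD] show ?thesis
    by (simp add: LD_def LD'_def)
qed

text \<open>No local term appears: the outer weights of \<open>LD'\<close> are the inner ones, so
  the two contributions from the limits of integration cancel.\<close>

lemma DERIV_LD':
  assumes f: "continuous_on {-L..L} f" and x: "x \<in> {-L..L}"
  shows "(LD' f has_real_derivative LD'' f x) (at x within {-L..L})"
proof -
  have "((\<lambda>x. cosh ((L + x) / sqrt d) / sqrt d) has_real_derivative sinh ((L + x) / sqrt d) / d) (at x within {-L..L})"
    "((\<lambda>x. - cosh ((L - x) / sqrt d) / sqrt d) has_real_derivative sinh ((L - x) / sqrt d) / d) (at x within {-L..L})" for x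
    using d by (auto intro!: derivative_eq_intros simp: mult.assoc)
  from DERIV_green_op[OF continuous_omega'(3,4) f this x, of cD] show ?thesis
    by (simp add: LD'_def LD''_def)
qed

text \<open>The outer weights of these three operators are multiples of \<open>sinh\<close>,
  vanishing where the remaining integral does not. This is what makes the boundary equations
  homogeneous.\<close>

lemma boundary_values:
  "LN' f L = 0" "LN' f (-L) = 0" "LD f L = 0" "LD f (-L) = 0" "LD'' f L = 0" "LD'' f (-L) = 0"
  by (simp_all add: LN'_def LD_def LD''_def green_op_boundary)

section \<open>The nonlinear right-hand side and its Lipschitz estimate\<close>

definition flux :: "(real \<Rightarrow> real) \<Rightarrow> (real \<Rightarrow> real) \<Rightarrow> real \<Rightarrow> real" where
  "flux \<eta> u = (\<lambda>\<xi>. (a + b) / b * u \<xi> + \<eta> \<xi> * u \<xi>)"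

definition head :: "(real \<Rightarrow> real) \<Rightarrow> (real \<Rightarrow> real) \<Rightarrow> real \<Rightarrow> real" where
  "head \<eta> u = (\<lambda>\<xi>. \<eta> \<xi> + 1 / 2 * (u \<xi>)\<^sup>2)"

text \<open>By \<open>DERIV_LD\<close>, the third component is the \<open>x\<close>-derivative of
  the second, as it must be for \<open>v\<close> to remain \<open>u\<^sub>x\<close>.\<close>

definition vf :: "(real \<Rightarrow> real \<times> real \<times> real) \<Rightarrow> real \<Rightarrow> real \<times> real \<times> real" where
  "vf f x = (let \<eta> = \<lambda>\<xi>. fst (f \<xi>); u = \<lambda>\<xi>. fst (snd (f \<xi>)); v = \<lambda>\<xi>. snd (snd (f \<xi>)) in
     (LN (flux \<eta> u) x + a / b * v x, LD (head \<eta> u) x, LD' (head \<eta> u) x + head \<eta> u x / d))"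

lemma jointly_C_flux:
  "jointly_C T L k \<eta> \<Longrightarrow> jointly_C T L k u \<Longrightarrow> jointly_C T L k (\<lambda>t. flux (\<eta> t) (u t))"
  unfolding flux_def by (intro jointly_C_add jointly_C_cmult jointly_C_mult)

lemma jointly_C_head:
  "jointly_C T L k \<eta> \<Longrightarrow> jointly_C T L k u \<Longrightarrow> jointly_C T L k (\<lambda>t. head (\<eta> t) (u t))"
  unfolding head_def power2_eq_square by (intro jointly_C_add jointly_C_cmult jointly_C_mult)

lemma continuous_flux:
  "continuous_on S \<eta> \<Longrightarrow> continuous_on S u \<Longrightarrow> continuous_on S (flux \<eta> u)"
  unfolding flux_def by (intro continuous_intros)

lemma continuous_head:
  "continuous_on S \<eta> \<Longrightarrow> continuous_on S u \<Longrightarrow> continuous_on S (head \<eta> u)"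
  unfolding head_def by (intro continuous_intros)

lemma vf_continuous:
  fixes T :: real
  assumes "continuous_on ({0..T} \<times> {-L..L}) (\<lambda>(t, x). U t x)"
  shows "continuous_on ({0..T} \<times> {-L..L}) (\<lambda>(t, x). vf (U t) x)"
proof -
  have c: "jointly_C T L 0 (\<lambda>t x. fst (U t x))" "jointly_C T L 0 (\<lambda>t x. fst (snd (U t x)))"
    "jointly_C T L 0 (\<lambda>t x. snd (snd (U t x)))"
    using assms by (auto simp: split_def intro!: continuous_intros)
  note N = jointly_C_flux[OF c(1,2)] and D = jointly_C_head[OF c(1,2)]
  have "jointly_C T L 0 (\<lambda>t x. LN (flux (\<lambda>\<xi>. fst (U t \<xi>)) (\<lambda>\<xi>. fst (snd (U t \<xi>)))) x + a / b * snd (snd (U t x)))"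
    by (intro jointly_C_add jointly_C_cmult c jointly_C_SucD[OF jointly_C_LN[OF N]])
  moreover have "jointly_C T L 0 (\<lambda>t x. LD (head (\<lambda>\<xi>. fst (U t \<xi>)) (\<lambda>\<xi>. fst (snd (U t \<xi>)))) x)"
    by (intro jointly_C_SucD[OF jointly_C_LD[OF D]])
  moreover have "jointly_C T L 0 (\<lambda>t x. LD' (head (\<lambda>\<xi>. fst (U t \<xi>)) (\<lambda>\<xi>. fst (snd (U t \<xi>)))) x
      + 1 / d * head (\<lambda>\<xi>. fst (U t \<xi>)) (\<lambda>\<xi>. fst (snd (U t \<xi>))) x)"
    by (intro jointly_C_add jointly_C_cmult jointly_C_SucD[OF jointly_C_LD'[OF D]] D)
  ultimately show ?thesis
    by (simp add: vf_def Let_def split_def continuous_on_Pair)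
qed

lemma flux_diff_le:
  assumes "\<bar>\<eta> x\<bar> \<le> R" "\<bar>u' x\<bar> \<le> R" "\<bar>\<eta> x - \<eta>' x\<bar> \<le> \<delta>" "\<bar>u x - u' x\<bar> \<le> \<delta>"
  shows "\<bar>flux \<eta> u x - flux \<eta>' u' x\<bar> \<le> (\<bar>(a + b) / b\<bar> + 2 * R) * \<delta>"
proof -
  \<comment> \<open>Splitting the product this way requires bounds on \<open>\<eta>\<close> and
    \<open>u'\<close> only.\<close>
  have "flux \<eta> u x - flux \<eta>' u' x = (a + b) / b * (u x - u' x) + \<eta> x * (u x - u' x) + u' x * (\<eta> x - \<eta>' x)"
    unfolding flux_def by algebra
  moreover have "\<bar>(a + b) / b * (u x - u' x)\<bar> \<le> \<bar>(a + b) / b\<bar> * \<delta>"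
    "\<bar>\<eta> x * (u x - u' x)\<bar> \<le> R * \<delta>" "\<bar>u' x * (\<eta> x - \<eta>' x)\<bar> \<le> R * \<delta>"
    unfolding abs_mult using assms by (intro mult_mono; linarith)+
  moreover have "(\<bar>(a + b) / b\<bar> + 2 * R) * \<delta> = \<bar>(a + b) / b\<bar> * \<delta> + R * \<delta> + R * \<delta>"
    by (simp add: algebra_simps)
  ultimately show ?thesis by linarith
qed

lemma head_diff_le:
  assumes "\<bar>u x\<bar> \<le> R" "\<bar>u' x\<bar> \<le> R" "\<bar>\<eta> x - \<eta>' x\<bar> \<le> \<delta>" "\<bar>u x - u' x\<bar> \<le> \<delta>"
  shows "\<bar>head \<eta> u x - head \<eta>' u' x\<bar> \<le> (1 + R) * \<delta>"
proof -
  have "head \<eta> u x - head \<eta>' u' x = (\<eta> x - \<eta>' x) + 1 / 2 * ((u x + u' x) * (u x - u' x))"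
    by (simp add: head_def algebra_simps power2_eq_square)
  moreover have "\<bar>(u x + u' x) * (u x - u' x)\<bar> \<le> (2 * R) * \<delta>"
    unfolding abs_mult using assms by (intro mult_mono; linarith)
  moreover have "(1 + R) * \<delta> = \<delta> + 1 / 2 * ((2 * R) * \<delta>)" by (simp add: algebra_simps)
  ultimately show ?thesis using assms(3) by (simp add: abs_mult; linarith)
qed

lemma norm_triple_le: "norm (x, y, z) \<le> \<bar>x\<bar> + (\<bar>y\<bar> + \<bar>z\<bar>)" for x y z :: real
  using norm_Pair_le[of x "(y, z)"] norm_Pair_le[of y z] by simp

lemma vf_Lipschitz: "nonlocal_Lipschitz (-L) L vf"
  unfolding nonlocal_Lipschitz_def
proof (intro conjI allI impI)
  fix T :: real and U
  show "continuous_on ({0..T} \<times> {-L..L}) (\<lambda>(t, x). U t x) \<Longrightarrow>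
    continuous_on ({0..T} \<times> {-L..L}) (\<lambda>(t, x). vf (U t) x)"
    by (rule vf_continuous)
next
  fix R0 :: real
  \<comment> \<open>The radius is quantified over all reals; the absolute value keeps the constant
    \<open>K\<close> nonnegative when \<open>R0\<close> is negative.\<close>
  define R where "R = \<bar>R0\<bar>"
  obtain KN where KN: "KN \<ge> 0" "\<And>f \<delta> x. continuous_on {-L..L} f \<Longrightarrow> (\<And>x. x \<in> {-L..L} \<Longrightarrow> \<bar>f x\<bar> \<le> \<delta>) \<Longrightarrow>
     x \<in> {-L..L} \<Longrightarrow> \<bar>LN f x\<bar> \<le> KN * \<delta>"
    unfolding LN_def by (rule green_op_bound[OF continuous_omega(1,2)[OF b] continuous_omega'(1,2)]) blast
  obtain KD where KD: "KD \<ge> 0" "\<And>f \<delta> x. continuous_on {-L..L} f \<Longrightarrow> (\<And>x. x \<in> {-L..L} \<Longrightarrow> \<bar>f x\<bar> \<le> \<delta>) \<Longrightarrow>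
     x \<in> {-L..L} \<Longrightarrow> \<bar>LD f x\<bar> \<le> KD * \<delta>"
    unfolding LD_def by (rule green_op_bound[OF continuous_omega(3,4)[OF d] continuous_omega'(3,4)]) blast
  obtain KD' where KD': "KD' \<ge> 0" "\<And>f \<delta> x. continuous_on {-L..L} f \<Longrightarrow> (\<And>x. x \<in> {-L..L} \<Longrightarrow> \<bar>f x\<bar> \<le> \<delta>) \<Longrightarrow>
     x \<in> {-L..L} \<Longrightarrow> \<bar>LD' f x\<bar> \<le> KD' * \<delta>"
    unfolding LD'_def by (rule green_op_bound[OF continuous_omega'(3,4) continuous_omega'(3,4)]) blast
  define M where "M = \<bar>(a + b) / b\<bar> + 2 * R"
  define K where "K = KN * M + \<bar>a / b\<bar> + KD * (1 + R) + KD' * (1 + R) + (1 + R) / d"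
  have R: "R \<ge> 0" and M: "M \<ge> 0" by (auto simp: R_def M_def)
  have "norm (vf f x - vf g x) \<le> K * \<delta>"
    if f: "continuous_on {-L..L} f" and g: "continuous_on {-L..L} g"
      and fg: "\<And>x. x \<in> {-L..L} \<Longrightarrow> norm (f x) \<le> R0 \<and> norm (g x) \<le> R0 \<and> norm (f x - g x) \<le> \<delta>"
      and x: "x \<in> {-L..L}"
    for f g :: "real \<Rightarrow> real \<times> real \<times> real" and \<delta> x
  proof -
    define \<eta> u v where "\<eta> = (\<lambda>\<xi>. fst (f \<xi>))" and "u = (\<lambda>\<xi>. fst (snd (f \<xi>)))" and "v = (\<lambda>\<xi>. snd (snd (f \<xi>)))"
    define \<eta>' u' v' where "\<eta>' = (\<lambda>\<xi>. fst (g \<xi>))" and "u' = (\<lambda>\<xi>. fst (snd (g \<xi>)))" and "v' = (\<lambda>\<xi>. snd (snd (g \<xi>)))"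
    note defs = \<eta>_def u_def v_def \<eta>'_def u'_def v'_def
    have comp: "\<bar>fst p\<bar> \<le> norm p" "\<bar>fst (snd p)\<bar> \<le> norm p" "\<bar>snd (snd p)\<bar> \<le> norm p"
      for p :: "real \<times> real \<times> real"
      using norm_fst_le[of "fst p" "snd p"] norm_fst_le[of "fst (snd p)" "snd (snd p)"]
        norm_snd_le[of "snd (snd p)" "fst (snd p)"] norm_snd_le[of "snd p" "fst p"] by auto
    have bd: "\<bar>\<eta> y\<bar> \<le> R" "\<bar>u y\<bar> \<le> R" "\<bar>u' y\<bar> \<le> R" "\<bar>\<eta> y - \<eta>' y\<bar> \<le> \<delta>" "\<bar>u y - u' y\<bar> \<le> \<delta>" "\<bar>v y - v' y\<bar> \<le> \<delta>"
      if "y \<in> {-L..L}" for y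
    proof -
      have n: "norm (f y) \<le> R" "norm (g y) \<le> R" "norm (f y - g y) \<le> \<delta>"
        using fg[OF that] unfolding R_def by linarith+
      show "\<bar>\<eta> y\<bar> \<le> R" "\<bar>u y\<bar> \<le> R" "\<bar>u' y\<bar> \<le> R" "\<bar>\<eta> y - \<eta>' y\<bar> \<le> \<delta>" "\<bar>u y - u' y\<bar> \<le> \<delta>" "\<bar>v y - v' y\<bar> \<le> \<delta>"
        using comp[THEN order_trans, OF n(1)] comp[THEN order_trans, OF n(2)]
          comp[THEN order_trans, OF n(3)] by (simp_all add: defs)
    qed
    have c: "continuous_on {-L..L} \<eta>" "continuous_on {-L..L} u" "continuous_on {-L..L} \<eta>'" "continuous_on {-L..L} u'"
      using f g by (auto simp: defs intro!: continuous_intros)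
    have N: "\<bar>flux \<eta> u y - flux \<eta>' u' y\<bar> \<le> M * \<delta>" if "y \<in> {-L..L}" for y
      unfolding M_def by (intro flux_diff_le bd that)
    have D: "\<bar>head \<eta> u y - head \<eta>' u' y\<bar> \<le> (1 + R) * \<delta>" if "y \<in> {-L..L}" for y
      by (intro head_diff_le bd that)
    note cN = continuous_flux[OF c(1,2)] continuous_flux[OF c(3,4)]
    note cD = continuous_head[OF c(1,2)] continuous_head[OF c(3,4)]
    have 1: "\<bar>LN (flux \<eta> u) x - LN (flux \<eta>' u') x\<bar> \<le> KN * (M * \<delta>)"
      using KN(2)[OF continuous_on_diff[OF cN] N x] green_op_diff[OF continuous_omega'(1,2) cN x]
      by (simp add: LN_def)
    have 2: "\<bar>LD (head \<eta> u) x - LD (head \<eta>' u') x\<bar> \<le> KD * ((1 + R) * \<delta>)"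
      using KD(2)[OF continuous_on_diff[OF cD] D x] green_op_diff[OF continuous_omega'(3,4) cD x]
      by (simp add: LD_def)
    have 3: "\<bar>LD' (head \<eta> u) x - LD' (head \<eta>' u') x\<bar> \<le> KD' * ((1 + R) * \<delta>)"
      using KD'(2)[OF continuous_on_diff[OF cD] D x] green_op_diff[OF continuous_omega'(3,4) cD x]
      by (simp add: LD'_def)
    have 4: "\<bar>a / b * v x - a / b * v' x\<bar> \<le> \<bar>a / b\<bar> * \<delta>"
      unfolding right_diff_distrib[symmetric] abs_mult using bd[OF x] by (intro mult_left_mono) auto
    have 5: "\<bar>head \<eta> u x / d - head \<eta>' u' x / d\<bar> \<le> (1 + R) * \<delta> / d"
      unfolding diff_divide_distrib[symmetric] abs_divide using D[OF x] d by (simp add: divide_right_mono)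
    have "vf f x - vf g x = ((LN (flux \<eta> u) x - LN (flux \<eta>' u') x) + (a / b * v x - a / b * v' x),
        LD (head \<eta> u) x - LD (head \<eta>' u') x,
        (LD' (head \<eta> u) x - LD' (head \<eta>' u') x) + (head \<eta> u x / d - head \<eta>' u' x / d))"
      by (simp add: vf_def Let_def defs)
    then have "norm (vf f x - vf g x) \<le>
        \<bar>(LN (flux \<eta> u) x - LN (flux \<eta>' u') x) + (a / b * v x - a / b * v' x)\<bar> +
        (\<bar>LD (head \<eta> u) x - LD (head \<eta>' u') x\<bar> +
        \<bar>(LD' (head \<eta> u) x - LD' (head \<eta>' u') x) + (head \<eta> u x / d - head \<eta>' u' x / d)\<bar>)"
      by (simp only: norm_triple_le)
    also have "\<dots> \<le> (KN * (M * \<delta>) + \<bar>a / b\<bar> * \<delta>) + (KD * ((1 + R) * \<delta>) + (KD' * ((1 + R) * \<delta>) + (1 + R) * \<delta> / d))"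
      by (intro add_mono order_trans[OF abs_triangle_ineq add_mono] 1 2 3 4 5)
    also have "\<dots> = K * \<delta>" by (simp add: K_def distrib_right distrib_left mult.assoc times_divide_eq_left)
    finally show ?thesis .
  qed
  moreover have "K \<ge> 0"
    unfolding K_def using KN KD KD' M R d by simp
  ultimately show "\<exists>K\<ge>0. \<forall>f g \<delta>. continuous_on {-L..L} f \<longrightarrow> continuous_on {-L..L} g \<longrightarrow>
       (\<forall>x\<in>{-L..L}. norm (f x) \<le> R0 \<and> norm (g x) \<le> R0 \<and> norm (f x - g x) \<le> \<delta>) \<longrightarrow>
       (\<forall>x\<in>{-L..L}. norm (vf f x - vf g x) \<le> K * \<delta>)"
    by blast
qed

section \<open>Solutions of the extended system\<close>

text \<open>That \<open>v\<close> is the derivative of \<open>u\<close> is not demanded; it follows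
  in \<open>triple_solution_regular\<close> when the initial values are so related.\<close>

definition triple_solution where
  "triple_solution T \<eta>0 u0 v0 \<eta> u v \<longleftrightarrow>
     jointly_C T L 0 \<eta> \<and> jointly_C T L 0 u \<and> jointly_C T L 0 v \<and>
     (\<forall>t\<in>{0..T}. \<forall>x\<in>{-L..L}.
       \<eta> t x = \<eta>0 x + integral {0..t} (\<lambda>s. LN (flux (\<eta> s) (u s)) x + a / b * v s x) \<and>
       u t x = u0 x + integral {0..t} (\<lambda>s. LD (head (\<eta> s) (u s)) x) \<and>
       v t x = v0 x + integral {0..t} (\<lambda>s. LD' (head (\<eta> s) (u s)) x + head (\<eta> s) (u s) x / d))"

text \<open>The integral of a triple is taken componentwise by composing with the bounded linear
  projections.\<close>

lemma triple_solution_iff: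
  assumes "jointly_C T L 0 \<eta>" "jointly_C T L 0 u" "jointly_C T L 0 v"
  shows "triple_solution T \<eta>0 u0 v0 \<eta> u v \<longleftrightarrow> (\<forall>t\<in>{0..T}. \<forall>x\<in>{-L..L}.
    (\<eta> t x, u t x, v t x) = (\<eta>0 x, u0 x, v0 x) + integral {0..t} (\<lambda>s. vf (\<lambda>y. (\<eta> s y, u s y, v s y)) x))"
proof -
  have c: "continuous_on ({0..T} \<times> {-L..L}) (\<lambda>(t, x). (\<eta> t x, u t x, v t x))"
    using assms by (simp add: split_def continuous_on_Pair)
  have "integral {0..t} (\<lambda>s. vf (\<lambda>y. (\<eta> s y, u s y, v s y)) x) =
    (integral {0..t} (\<lambda>s. LN (flux (\<eta> s) (u s)) x + a / b * v s x),
     integral {0..t} (\<lambda>s. LD (head (\<eta> s) (u s)) x),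
     integral {0..t} (\<lambda>s. LD' (head (\<eta> s) (u s)) x + head (\<eta> s) (u s) x / d))"
    (is "integral _ ?f = _") if t: "t \<in> {0..T}" and x: "x \<in> {-L..L}" for t x
  proof -
    have i: "?f integrable_on {0..t}"
      by (rule integrable_continuous_real, rule continuous_on_subset[OF continuous_on_slice1[OF vf_continuous[OF c] x]])
        (use t in auto)
    have "integral {0..t} (fst \<circ> ?f) = fst (integral {0..t} ?f)"
      "integral {0..t} ((fst \<circ> snd) \<circ> ?f) = (fst \<circ> snd) (integral {0..t} ?f)"
      "integral {0..t} ((snd \<circ> snd) \<circ> ?f) = (snd \<circ> snd) (integral {0..t} ?f)"
      by (rule integral_linear[OF i]; intro bounded_linear_fst
          bounded_linear_compose[OF bounded_linear_fst bounded_linear_snd, folded o_def]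
          bounded_linear_compose[OF bounded_linear_snd bounded_linear_snd, folded o_def])+
    then show ?thesis
      by (intro prod_eqI) (simp_all add: vf_def Let_def o_def)
  qed
  then show ?thesis using assms by (auto simp: triple_solution_def)
qed

lemma triple_solution_exists:
  assumes "continuous_on {-L..L} \<eta>0" "continuous_on {-L..L} u0" "continuous_on {-L..L} v0"
  shows "\<exists>T>0. \<exists>\<eta> u v. triple_solution T \<eta>0 u0 v0 \<eta> u v"
proof -
  have lh: "-L \<le> L" using L by simp
  have "continuous_on {-L..L} (\<lambda>x. (\<eta>0 x, u0 x, v0 x))" by (intro continuous_intros assms)
  from picard_exists[OF vf_Lipschitz lh this] obtain T :: real and U where T: "T > 0"
    and U: "continuous_on ({0..T} \<times> {-L..L}) (\<lambda>(t, x). U t x)"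
      "\<forall>t\<in>{0..T}. \<forall>x\<in>{-L..L}. U t x = (\<eta>0 x, u0 x, v0 x) + integral {0..t} (\<lambda>s. vf (U s) x)"
    by blast
  have "triple_solution T \<eta>0 u0 v0 (\<lambda>t x. fst (U t x)) (\<lambda>t x. fst (snd (U t x))) (\<lambda>t x. snd (snd (U t x)))"
    by (subst triple_solution_iff) (use U in \<open>auto simp: split_def prod_eq_iff intro!: continuous_intros\<close>)
  with T show ?thesis by blast
qed

lemma triple_solution_unique:
  assumes 1: "triple_solution T \<eta>0 u0 v0 \<eta> u v" and 2: "triple_solution T \<eta>0 u0 v0 \<eta>' u' v'"
    and tx: "t \<in> {0..T}" "x \<in> {-L..L}"
  shows "\<eta> t x = \<eta>' t x" "u t x = u' t x"
proof -
  have c: "jointly_C T L 0 \<eta>" "jointly_C T L 0 u" "jointly_C T L 0 v"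
    "jointly_C T L 0 \<eta>'" "jointly_C T L 0 u'" "jointly_C T L 0 v'"
    using 1 2 unfolding triple_solution_def by blast+
  have "(\<lambda>t x. (\<eta> t x, u t x, v t x)) t x = (\<lambda>t x. (\<eta>' t x, u' t x, v' t x)) t x"
  proof (rule picard_unique[OF vf_Lipschitz _ _ _ _ tx])
    show "continuous_on ({0..T} \<times> {-L..L}) (\<lambda>(t, x). (\<eta> t x, u t x, v t x))"
      "continuous_on ({0..T} \<times> {-L..L}) (\<lambda>(t, x). (\<eta>' t x, u' t x, v' t x))"
      using c by (simp_all add: split_def continuous_on_Pair)
  qed (use 1[unfolded triple_solution_iff[OF c(1-3)]] 2[unfolded triple_solution_iff[OF c(4-6)]] in blast)+
  then show "\<eta> t x = \<eta>' t x" "u t x = u' t x" by auto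
qed

text \<open>Differentiating the equation for \<open>u\<close> under the time integral reproduces the
  right-hand side of the equation for \<open>v\<close>. This gives \<open>v = u\<^sub>x\<close> for
  the extended system, and the third equation for a solution of the original one.\<close>

lemma DERIV_head_flow:
  fixes T :: real
  assumes c: "jointly_C T L 0 \<eta>" "jointly_C T L 0 u"
    and eq: "\<And>t x. t \<in> {0..T} \<Longrightarrow> x \<in> {-L..L} \<Longrightarrow>
       u t x = u0 x + integral {0..t} (\<lambda>s. LD (head (\<eta> s) (u s)) x)"
    and u0: "\<And>x. x \<in> {-L..L} \<Longrightarrow> (u0 has_real_derivative v0 x) (at x within {-L..L})"
    and t: "t \<in> {0..T}" and x: "x \<in> {-L..L}"
  shows "(u t has_real_derivative v0 x + integral {0..t} (\<lambda>s. LD' (head (\<eta> s) (u s)) x + head (\<eta> s) (u s) x / d))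
    (at x within {-L..L})"
proof -
  note h = jointly_C_head[OF c]
  have "jointly_C T L 0 (\<lambda>t x. LD' (head (\<eta> t) (u t)) x + 1 / d * head (\<eta> t) (u t) x)"
    by (intro jointly_C_add jointly_C_cmult h jointly_C_SucD[OF jointly_C_LD'[OF h]])
  then have "continuous_on ({0..T} \<times> {-L..L}) (\<lambda>(t, x). LD' (head (\<eta> t) (u t)) x + head (\<eta> t) (u t) x / d)"
    by (simp add: split_def)
  from DERIV_time_integral[OF jointly_C_continuous[OF jointly_C_LD[OF h]] this _ t x]
  have "((\<lambda>x. integral {0..t} (\<lambda>s. LD (head (\<eta> s) (u s)) x)) has_real_derivative
      integral {0..t} (\<lambda>s. LD' (head (\<eta> s) (u s)) x + head (\<eta> s) (u s) x / d)) (at x within {-L..L})"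
    using DERIV_LD continuous_on_slice2[OF jointly_C_continuous[OF h]] by blast
  from DERIV_add[OF u0[OF x] this] show ?thesis
    by (subst has_real_derivative_within_cong[OF eq[OF t] x])
qed

lemma triple_solution_regular:
  assumes sol: "triple_solution T \<eta>0 u0 v0 \<eta> u v"
    and init: "jointly_C T L m (\<lambda>t. \<eta>0)" "jointly_C T L (Suc m) (\<lambda>t. u0)" "jointly_C T L m (\<lambda>t. v0)"
    and v0: "\<And>x. x \<in> {-L..L} \<Longrightarrow> (u0 has_real_derivative v0 x) (at x within {-L..L})"
  shows "jointly_C T L m \<eta>" "jointly_C T L (Suc m) u" "jointly_C T L m v"
    and "\<And>t x. t \<in> {0..T} \<Longrightarrow> x \<in> {-L..L} \<Longrightarrow> (u t has_real_derivative v t x) (at x within {-L..L})"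
proof -
  have c: "jointly_C T L 0 \<eta>" "jointly_C T L 0 u" "jointly_C T L 0 v"
    and eq: "\<And>t x. t \<in> {0..T} \<Longrightarrow> x \<in> {-L..L} \<Longrightarrow>
       \<eta> t x = \<eta>0 x + integral {0..t} (\<lambda>s. LN (flux (\<eta> s) (u s)) x + a / b * v s x)"
    "\<And>t x. t \<in> {0..T} \<Longrightarrow> x \<in> {-L..L} \<Longrightarrow>
       u t x = u0 x + integral {0..t} (\<lambda>s. LD (head (\<eta> s) (u s)) x)"
    "\<And>t x. t \<in> {0..T} \<Longrightarrow> x \<in> {-L..L} \<Longrightarrow>
       v t x = v0 x + integral {0..t} (\<lambda>s. LD' (head (\<eta> s) (u s)) x + head (\<eta> s) (u s) x / d)"
    using sol unfolding triple_solution_def by blast+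
  show du: "(u t has_real_derivative v t x) (at x within {-L..L})" if t: "t \<in> {0..T}" and x: "x \<in> {-L..L}" for t x
    using DERIV_head_flow[OF c(1,2) eq(2) v0 t x] by (simp only: eq(3)[OF t x])
  have "jointly_C T L k \<eta> \<and> jointly_C T L (Suc k) u \<and> jointly_C T L k v" if "k \<le> m" for k
    using that
  proof (induction k)
    case 0
    show ?case using c by (intro conjI jointly_C_SucI[OF _ _ du])
  next
    case (Suc k)
    then have k: "jointly_C T L k \<eta>" "jointly_C T L (Suc k) u" "jointly_C T L k v" by auto
    note ku = jointly_C_SucD[OF k(2)]
    note N = jointly_C_LN[OF jointly_C_flux[OF k(1) ku]] and D = jointly_C_LD'[OF jointly_C_head[OF k(1) ku]]
    \<comment> \<open>From \<open>head / d\<close> the part \<open>\<eta> / d\<close> is kept as the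
      coupling term. The quadratic part goes into \<open>g2\<close>, where order
      \<open>Suc k\<close> is available because \<open>u\<close> is one order ahead of
      \<open>\<eta>\<close> and \<open>v\<close>.\<close>
    have g2: "jointly_C T L (Suc k) (\<lambda>t x. LD' (head (\<eta> t) (u t)) x + 1 / (2 * d) * (u t x * u t x))"
      by (intro jointly_C_add D jointly_C_cmult jointly_C_mult[OF k(2) k(2)])
    have "\<eta> t x = \<eta>0 x + integral {0..t} (\<lambda>s. LN (flux (\<eta> s) (u s)) x - (- (a / b)) * v s x)"
      if "t \<in> {0..T}" "x \<in> {-L..L}" for t x
      using eq(1)[OF that] by simp
    moreover have "LD' (head (\<eta> s) (u s)) x + 1 / (2 * d) * (u s x * u s x) + 1 / d * \<eta> s x =
        LD' (head (\<eta> s) (u s)) x + head (\<eta> s) (u s) x / d" for s x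
      by (simp add: head_def add_divide_distrib power2_eq_square)
    then have "v t x = v0 x + integral {0..t}
        (\<lambda>s. LD' (head (\<eta> s) (u s)) x + 1 / (2 * d) * (u s x * u s x) + 1 / d * \<eta> s x)"
      if "t \<in> {0..T}" "x \<in> {-L..L}" for t x
      using eq(3)[OF that] by (simp only:)
    moreover have "- (a / b) > 0" "1 / d > 0" using a b d by (auto simp: divide_neg_pos)
    ultimately have "jointly_C T L (Suc k) \<eta> \<and> jointly_C T L (Suc k) v"
      using jointly_C_variation_of_constants[OF _ _ c(1,3) N g2
          jointly_C_mono[OF init(1) Suc.prems] jointly_C_mono[OF init(3) Suc.prems]] by blast
    \<comment> \<open>The new order of \<open>v = u\<^sub>x\<close> keeps \<open>u\<close> one
      ahead.\<close>
    moreover from this have "jointly_C T L (Suc (Suc k)) u"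
      by (intro jointly_C_SucI[OF k(2) _ du]) auto
    ultimately show ?case by blast
  qed
  from this[of m] show "jointly_C T L m \<eta>" "jointly_C T L (Suc m) u" "jointly_C T L m v" by auto
qed

text \<open>Since \<open>LD\<close> vanishes at \<open>e\<close>, so does \<open>u\<close>, and with
  it the flux. Differentiating the equations for \<open>\<eta>\<close> and \<open>v\<close> at
  \<open>e\<close>, the terms \<open>LN'\<close>, \<open>LD''\<close> and \<open>u * v\<close> drop
  out as well, leaving only the mutual coupling of \<open>\<eta>\<^sub>x\<close> and
  \<open>v\<^sub>x\<close>.\<close>

lemma triple_solution_boundary:
  assumes sol: "triple_solution T \<eta>0 u0 v0 \<eta> u v"
    and init: "\<eta>0 \<in> C_space L (Suc n)" "u0 \<in> C_space L (Suc (Suc n))" "v0 = Dx L u0"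
    and e: "e = L \<or> e = -L" "Dx L \<eta>0 e = 0" "u0 e = 0" "Dx L v0 e = 0"
    and t: "t \<in> {0..T}"
  shows "Dx L (\<eta> t) e = 0" "u t e = 0" "Dx L (v t) e = 0"
proof -
  have eI: "e \<in> {-L..L}" using e L by auto
  have c: "jointly_C T L 0 \<eta>" "jointly_C T L 0 u" "jointly_C T L 0 v"
    and eq: "\<And>t x. t \<in> {0..T} \<Longrightarrow> x \<in> {-L..L} \<Longrightarrow>
       \<eta> t x = \<eta>0 x + integral {0..t} (\<lambda>s. LN (flux (\<eta> s) (u s)) x + a / b * v s x)"
    "\<And>t x. t \<in> {0..T} \<Longrightarrow> x \<in> {-L..L} \<Longrightarrow>
       u t x = u0 x + integral {0..t} (\<lambda>s. LD (head (\<eta> s) (u s)) x)"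
    "\<And>t x. t \<in> {0..T} \<Longrightarrow> x \<in> {-L..L} \<Longrightarrow>
       v t x = v0 x + integral {0..t} (\<lambda>s. LD' (head (\<eta> s) (u s)) x + head (\<eta> s) (u s) x / d)"
    using sol unfolding triple_solution_def by blast+
  have v0: "v0 \<in> C_space L (Suc n)" using C_space_Suc(1)[OF init(2)] init(3) by simp
  have reg: "jointly_C T L (Suc n) \<eta>" "jointly_C T L (Suc (Suc n)) u" "jointly_C T L (Suc n) v"
    and du: "\<And>t x. t \<in> {0..T} \<Longrightarrow> x \<in> {-L..L} \<Longrightarrow> (u t has_real_derivative v t x) (at x within {-L..L})"
    using triple_solution_regular[OF sol jointly_C_of_C_space[OF init(1)] jointly_C_of_C_space[OF init(2)]
        jointly_C_of_C_space[OF v0]] C_space_Suc(3)[OF init(2)] init(3) by auto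
  have sp: "\<eta> t \<in> C_space L (Suc n)" "v t \<in> C_space L (Suc n)" if "t \<in> {0..T}" for t
    using jointly_C_imp[OF L reg(1)] jointly_C_imp[OF L reg(3)] that by auto
  note d\<eta> = C_space_Suc(3)[OF sp(1)] and dv = C_space_Suc(3)[OF sp(2)]
  have "jointly_C T L n (\<lambda>t. Dxn L 1 (\<eta> t))" "jointly_C T L n (\<lambda>t. Dxn L 1 (v t))"
    using conjunct2[OF jointly_C_imp[OF L reg(1)]] conjunct2[OF jointly_C_imp[OF L reg(3)]]
    by (auto dest!: spec[of _ 1])
  then have D: "jointly_C T L 0 (\<lambda>t. Dx L (\<eta> t))" "jointly_C T L 0 (\<lambda>t. Dx L (v t))"
    by (auto simp: Dxn_Suc dest!: jointly_C_mono[of _ _ _ _ 0] simp del: jointly_C.simps)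
  note N = jointly_C_flux[OF c(1,2)] and h = jointly_C_head[OF c(1,2)]
  have ch: "continuous_on {-L..L} (head (\<eta> t) (u t))" "continuous_on {-L..L} (flux (\<eta> t) (u t))"
    if "t \<in> {0..T}" for t
    using continuous_on_slice2[OF jointly_C_continuous[OF h] that]
      continuous_on_slice2[OF jointly_C_continuous[OF N] that] by auto
  have u: "u t e = 0" if t: "t \<in> {0..T}" for t
    using eq(2)[OF t eI] e boundary_values(3,4) by auto
  show "u t e = 0" by (rule u[OF t])
  have flux0: "flux (\<eta> t) (u t) e = 0" if "t \<in> {0..T}" for t
    using u[OF that] by (simp add: flux_def)
  have y: "Dx L (\<eta> t) e = 0 + integral {0..t} (\<lambda>s. 0 - (- (a / b)) * Dx L (v s) e)" if t: "t \<in> {0..T}" for t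
  proof -
    let ?f = "\<lambda>s x. LN (flux (\<eta> s) (u s)) x + a / b * v s x"
    let ?g = "\<lambda>s x. LN' (flux (\<eta> s) (u s)) x + 1 / b * flux (\<eta> s) (u s) x + a / b * Dx L (v s) x"
    have f: "jointly_C T L 0 ?f"
      by (intro jointly_C_add jointly_C_cmult c jointly_C_SucD[OF jointly_C_LN[OF N]])
    have g: "jointly_C T L 0 ?g"
      by (intro jointly_C_add jointly_C_cmult D N jointly_C_SucD[OF jointly_C_LN'[OF N]])
    have "((\<lambda>x. integral {0..t} (\<lambda>s. ?f s x)) has_real_derivative integral {0..t} (\<lambda>s. ?g s e)) (at e within {-L..L})"
    proof (rule DERIV_time_integral[OF jointly_C_continuous[OF f] jointly_C_continuous[OF g] _ t eI])
      fix s x assume s: "s \<in> {0..T}" and x: "x \<in> {-L..L}"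
      show "(?f s has_real_derivative ?g s x) (at x within {-L..L})"
        using DERIV_add[OF DERIV_LN[OF ch(2)[OF s] x] DERIV_cmult[OF dv[OF s x], of "a / b"]] by simp
    qed
    from DERIV_add[OF C_space_Suc(3)[OF init(1) eI] this]
    have "(\<eta> t has_real_derivative Dx L \<eta>0 e + integral {0..t} (\<lambda>s. ?g s e)) (at e within {-L..L})"
      by (subst has_real_derivative_within_cong[OF eq(1)[OF t] eI])
    then have "Dx L (\<eta> t) e = Dx L \<eta>0 e + integral {0..t} (\<lambda>s. ?g s e)"
      by (rule Dx_eqI[OF L eI])
    also have "integral {0..t} (\<lambda>s. ?g s e) = integral {0..t} (\<lambda>s. 0 - (- (a / b)) * Dx L (v s) e)"
      using e(1) t by (intro integral_cong) (auto simp: boundary_values flux0)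
    finally show ?thesis using e by simp
  qed
  have z: "Dx L (v t) e = 0 + integral {0..t} (\<lambda>s. 0 + 1 / d * Dx L (\<eta> s) e)" if t: "t \<in> {0..T}" for t
  proof -
    let ?f = "\<lambda>s x. LD' (head (\<eta> s) (u s)) x + 1 / d * head (\<eta> s) (u s) x"
    let ?g = "\<lambda>s x. LD'' (head (\<eta> s) (u s)) x + 1 / d * (Dx L (\<eta> s) x + u s x * v s x)"
    have f: "jointly_C T L 0 ?f"
      by (intro jointly_C_add jointly_C_cmult h jointly_C_SucD[OF jointly_C_LD'[OF h]])
    have g: "jointly_C T L 0 ?g"
      by (intro jointly_C_add jointly_C_cmult jointly_C_mult c D jointly_C_SucD[OF jointly_C_LD''[OF h]])
    have "((\<lambda>x. integral {0..t} (\<lambda>s. ?f s x)) has_real_derivative integral {0..t} (\<lambda>s. ?g s e)) (at e within {-L..L})"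
    proof (rule DERIV_time_integral[OF jointly_C_continuous[OF f] jointly_C_continuous[OF g] _ t eI])
      fix s x assume s: "s \<in> {0..T}" and x: "x \<in> {-L..L}"
      have "(head (\<eta> s) (u s) has_real_derivative Dx L (\<eta> s) x + u s x * v s x) (at x within {-L..L})"
        unfolding head_def by (rule derivative_eq_intros d\<eta>[OF s x] du[OF s x] refl | simp)+
      from DERIV_add[OF DERIV_LD'[OF ch(1)[OF s] x] DERIV_cmult[OF this, of "1 / d"]]
      show "(?f s has_real_derivative ?g s x) (at x within {-L..L})" .
    qed
    from DERIV_add[OF C_space_Suc(3)[OF v0 eI] this]
    have "(v t has_real_derivative Dx L v0 e + integral {0..t} (\<lambda>s. ?g s e)) (at e within {-L..L})"
      using eq(3)[OF t] by (subst has_real_derivative_within_cong[OF _ eI]) auto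
    then have "Dx L (v t) e = Dx L v0 e + integral {0..t} (\<lambda>s. ?g s e)"
      by (rule Dx_eqI[OF L eI])
    also have "integral {0..t} (\<lambda>s. ?g s e) = integral {0..t} (\<lambda>s. 0 + 1 / d * Dx L (\<eta> s) e)"
      using e(1) t by (intro integral_cong) (auto simp: boundary_values u)
    finally show ?thesis using e by simp
  qed
  have pos: "- (a / b) > 0" "1 / d > 0" using a b d by (auto simp: divide_neg_pos)
  \<comment> \<open>Initial values and inhomogeneities are zero here, so \<open>P\<close> and
    \<open>Q\<close> vanish and both formulas give 0.\<close>
  note voc = variation_of_constants[OF pos refl continuous_on_slice1[OF jointly_C_continuous[OF D(1)] eI]
      continuous_on_slice1[OF jointly_C_continuous[OF D(2)] eI] continuous_on_const continuous_on_const y z t]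
  show "Dx L (\<eta> t) e = 0" using voc(1) by simp
  show "Dx L (v t) e = 0" using voc(2) by simp
qed

section \<open>Passage between the original and the extended system\<close>

lemma rhs_eq:
  assumes c: "jointly_C T L 0 \<eta>" "jointly_C T L 0 u"
    and v: "\<forall>t\<in>{0..T}. Dx L (u t) x = v t x"
    and t: "t \<in> {0..T}" and x: "x \<in> {-L..L}"
  shows "integral {0..t} (\<lambda>\<tau>. L_N L b (\<lambda>\<xi>. (a + b) / b * u \<tau> \<xi> + \<eta> \<tau> \<xi> * u \<tau> \<xi>) x + a / b * Dx L (u \<tau>) x)
      = integral {0..t} (\<lambda>s. LN (flux (\<eta> s) (u s)) x + a / b * v s x)"
    "integral {0..t} (\<lambda>\<tau>. L_D L d (\<lambda>\<xi>. \<eta> \<tau> \<xi> + 1 / 2 * (u \<tau> \<xi>)\<^sup>2) x)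
      = integral {0..t} (\<lambda>s. LD (head (\<eta> s) (u s)) x)"
proof -
  have ch: "continuous_on {-L..L} (head (\<eta> t) (u t))" "continuous_on {-L..L} (flux (\<eta> t) (u t))"
    if "t \<in> {0..T}" for t
    using continuous_on_slice2[OF jointly_C_continuous[OF jointly_C_head[OF c]] that]
      continuous_on_slice2[OF jointly_C_continuous[OF jointly_C_flux[OF c]] that] by auto
  have s: "s \<in> {0..T}" if "s \<in> {0..t}" for s using that t by auto
  show "integral {0..t} (\<lambda>\<tau>. L_N L b (\<lambda>\<xi>. (a + b) / b * u \<tau> \<xi> + \<eta> \<tau> \<xi> * u \<tau> \<xi>) x + a / b * Dx L (u \<tau>) x)
      = integral {0..t} (\<lambda>s. LN (flux (\<eta> s) (u s)) x + a / b * v s x)"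
    unfolding flux_def[symmetric] using s x by (intro integral_cong) (simp add: L_N_eq_LN[OF ch(2)] v)
  show "integral {0..t} (\<lambda>\<tau>. L_D L d (\<lambda>\<xi>. \<eta> \<tau> \<xi> + 1 / 2 * (u \<tau> \<xi>)\<^sup>2) x)
      = integral {0..t} (\<lambda>s. LD (head (\<eta> s) (u s)) x)"
    unfolding head_def[symmetric] using s x by (intro integral_cong) (simp add: L_D_eq_LD[OF ch(1)])
qed

text \<open>Membership of \<open>u\<close> in \<open>C(0,T;C^(m+1))\<close> makes
  \<open>u\<^sub>x\<close> jointly continuous, so \<open>u\<^sub>x\<close> itself can serve as the
  third unknown.\<close>

lemma is_solution_imp_triple_solution:
  assumes sol: "is_solution L a b d m \<eta>0 u0 T \<eta> u" and u0: "u0 \<in> C_space L (m + 1)"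
  shows "triple_solution T \<eta>0 u0 (Dx L u0) \<eta> u (\<lambda>t. Dx L (u t))"
proof -
  have \<eta>: "\<eta> \<in> C_time T (C0_tilde_space L m) (C_norm L m)"
    and u: "u \<in> C_time T (C0_space L (m + 1)) (C_norm L (m + 1))"
    and eq: "\<And>t x. t \<in> {0..T} \<Longrightarrow> x \<in> {-L..L} \<Longrightarrow>
        \<eta> t x = \<eta>0 x + integral {0..t} (\<lambda>\<tau>.
            L_N L b (\<lambda>\<xi>. (a + b) / b * u \<tau> \<xi> + \<eta> \<tau> \<xi> * u \<tau> \<xi>) x + a / b * Dx L (u \<tau>) x)"
      "\<And>t x. t \<in> {0..T} \<Longrightarrow> x \<in> {-L..L} \<Longrightarrow>
        u t x = u0 x + integral {0..t} (\<lambda>\<tau>. L_D L d (\<lambda>\<xi>. \<eta> \<tau> \<xi> + 1 / 2 * (u \<tau> \<xi>)\<^sup>2) x)"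
    using sol unfolding is_solution_def by blast+
  have sub: "C0_tilde_space L m \<subseteq> C_space L m" "C0_space L (m + 1) \<subseteq> C_space L (m + 1)"
    by (auto simp: C0_tilde_space_def C0_space_def)
  have c: "jointly_C T L 0 \<eta>" "jointly_C T L 0 u" "jointly_C T L 0 (\<lambda>t. Dx L (u t))"
    using C_time_continuous_Dxn[OF L \<eta> sub(1), of 0] C_time_continuous_Dxn[OF L u sub(2), of 0]
      C_time_continuous_Dxn[OF L u sub(2), of 1] by (auto simp: Dxn_Suc)
  have 1: "\<eta> t x = \<eta>0 x + integral {0..t} (\<lambda>s. LN (flux (\<eta> s) (u s)) x + a / b * Dx L (u s) x)"
    "u t x = u0 x + integral {0..t} (\<lambda>s. LD (head (\<eta> s) (u s)) x)"
    if "t \<in> {0..T}" "x \<in> {-L..L}" for t x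
    using eq(1)[OF that] eq(2)[OF that]
      rhs_eq[where v = "\<lambda>t. Dx L (u t)", OF c(1,2) _ that] by auto
  have "Dx L (u t) x = Dx L u0 x + integral {0..t} (\<lambda>s. LD' (head (\<eta> s) (u s)) x + head (\<eta> s) (u s) x / d)"
    if t: "t \<in> {0..T}" and x: "x \<in> {-L..L}" for t x
    using DERIV_head_flow[OF c(1,2) 1(2) _ t x] C_space_Suc(3)[of u0 L m] u0 by (intro Dx_eqI[OF L x]) auto
  with 1 c show ?thesis unfolding triple_solution_def by blast
qed

lemma triple_solution_imp_is_solution:
  assumes sol: "triple_solution T \<eta>0 u0 (Dx L u0) \<eta> u v" and m: "m \<ge> 1"
    and init: "\<eta>0 \<in> C0_tilde_space L m" "u0 \<in> C0_space L (m + 1)"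
  shows "is_solution L a b d m \<eta>0 u0 T \<eta> u"
proof -
  \<comment> \<open>Here \<open>m \<ge> 1\<close> enters: the boundary argument needs
    \<open>\<eta>\<^sub>x\<close> and \<open>v\<^sub>x\<close> to be continuous.\<close>
  obtain n where n: "m = Suc n" using m by (cases m) auto
  have i: "\<eta>0 \<in> C_space L (Suc n)" "u0 \<in> C_space L (Suc (Suc n))"
    using init by (auto simp: C0_tilde_space_def C0_space_def n)
  note v0 = C_space_Suc(1)[OF i(2)]
  have e: "Dx L \<eta>0 e = 0" "u0 e = 0" "Dx L (Dx L u0) e = 0" if "e = L \<or> e = -L" for e
    using init that by (auto simp: C0_tilde_space_def C0_space_def Dxn_Suc numeral_2_eq_2)
  have c: "jointly_C T L 0 \<eta>" "jointly_C T L 0 u" using sol by (simp_all add: triple_solution_def)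
  have reg: "jointly_C T L (Suc n) \<eta>" "jointly_C T L (Suc (Suc n)) u"
    and du: "\<And>t x. t \<in> {0..T} \<Longrightarrow> x \<in> {-L..L} \<Longrightarrow> (u t has_real_derivative v t x) (at x within {-L..L})"
    using triple_solution_regular[OF sol jointly_C_of_C_space[OF i(1)] jointly_C_of_C_space[OF i(2)]
        jointly_C_of_C_space[OF v0]] C_space_Suc(3)[OF i(2)] by auto
  have Du: "Dx L (u t) x = v t x" if "t \<in> {0..T}" "x \<in> {-L..L}" for t x
    using Dx_eqI[OF L that(2) du[OF that]] .
  have bd: "Dx L (\<eta> t) e = 0" "u t e = 0" "Dx L (Dx L (u t)) e = 0"
    if t: "t \<in> {0..T}" and el: "e = L \<or> e = -L" for t e
  proof -
    note B = triple_solution_boundary[OF sol i refl el e[OF el] t]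
    have "e \<in> {-L..L}" using el L by auto
    then have "Dx L (Dx L (u t)) e = Dx L (v t) e" using Du[OF t] by (intro Dx_cong) auto
    with B show "Dx L (\<eta> t) e = 0" "u t e = 0" "Dx L (Dx L (u t)) e = 0" by auto
  qed
  have "\<eta> \<in> C_time T (C0_tilde_space L m) (C_norm L m)"
    by (rule jointly_C_imp_C_time[OF L])
      (use reg(1) jointly_C_imp[OF L reg(1)] bd in \<open>auto simp: n C0_tilde_space_def simp del: jointly_C.simps\<close>)
  moreover have "u \<in> C_time T (C0_space L (m + 1)) (C_norm L (m + 1))"
    by (rule jointly_C_imp_C_time[OF L])
      (use reg(2) jointly_C_imp[OF L reg(2)] bd in \<open>auto simp: n C0_space_def Dxn_Suc numeral_2_eq_2 simp del: jointly_C.simps\<close>)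
  moreover have "\<eta> t x = \<eta>0 x + integral {0..t} (\<lambda>\<tau>.
        L_N L b (\<lambda>\<xi>. (a + b) / b * u \<tau> \<xi> + \<eta> \<tau> \<xi> * u \<tau> \<xi>) x + a / b * Dx L (u \<tau>) x) \<and>
      u t x = u0 x + integral {0..t} (\<lambda>\<tau>. L_D L d (\<lambda>\<xi>. \<eta> \<tau> \<xi> + 1 / 2 * (u \<tau> \<xi>)\<^sup>2) x)"
    if t: "t \<in> {0..T}" and x: "x \<in> {-L..L}" for t x
  proof -
    have "\<forall>t\<in>{0..T}. Dx L (u t) x = v t x" using Du x by blast
    from rhs_eq[where v = v, OF c this t x] show ?thesis
      using sol t x unfolding triple_solution_def by simp
  qed
  ultimately show ?thesis unfolding is_solution_def by blast
qed

end

theorem proposition3p3: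
  fixes L a b d :: real and m :: nat and \<eta>0 u0 :: "real \<Rightarrow> real"
  assumes "L > 0" and "a < 0" and "b > 0" and "d > 0" and "a + b + d = 1 / 3"
    and "m \<ge> 1"
    and "\<eta>0 \<in> C0_tilde_space L m" and "u0 \<in> C0_space L (m + 1)"
  shows "\<exists>T>0. \<exists>\<eta> u. is_solution L a b d m \<eta>0 u0 T \<eta> u \<and>
    (\<forall>\<eta>' u'. is_solution L a b d m \<eta>0 u0 T \<eta>' u' \<longrightarrow>
       (\<forall>t\<in>{0..T}. \<forall>x\<in>{-L..L}. \<eta>' t x = \<eta> t x \<and> u' t x = u t x))"
proof -
  interpret boussinesq L a b d by unfold_locales fact+
  have \<eta>0: "\<eta>0 \<in> C_space L m" and u0: "u0 \<in> C_space L (Suc m)"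
    using assms(7,8) by (auto simp: C0_tilde_space_def C0_space_def)
  \<comment> \<open>This \<open>T\<close> is obtained from continuity of \<open>\<eta>0\<close>,
    \<open>u0\<close> and \<open>Dx L u0\<close> alone and is not reduced later.\<close>
  obtain T \<eta> u v where T: "T > 0" and sol: "triple_solution T \<eta>0 u0 (Dx L u0) \<eta> u v"
    using triple_solution_exists[OF C_space_continuous[OF \<eta>0] C_space_continuous[OF u0]
        C_space_continuous[OF C_space_Suc(1)[OF u0]]] by blast
  have "is_solution L a b d m \<eta>0 u0 T \<eta> u"
    by (rule triple_solution_imp_is_solution[OF sol assms(6-8)])
  moreover have "\<eta>' t x = \<eta> t x \<and> u' t x = u t x"
    if "is_solution L a b d m \<eta>0 u0 T \<eta>' u'" "t \<in> {0..T}" "x \<in> {-L..L}" for \<eta>' u' t x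
    using triple_solution_unique[OF is_solution_imp_triple_solution[OF that(1)] sol that(2,3)] u0 by simp
  ultimately show ?thesis using T by blast
qed

end
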